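(* Let $X$ be a finite set with $|X|=n$, and let $a\in\mathcal T_X$ be an idempotent with $r=\operatorname{rank}(a)$, where $1<r<n$. The ideals of $P=\operatorname{Reg}(\mathcal T_X^a)$ are precisely the sets $$I_m^a=\bigcup_{j=1}^m D_j^a=\{f\in P:\operatorname{rank}(f)\le m\}\qquad\text{for }1\le m\le r,$$ and they form a chain: $I_1^a\subseteq\cdots\subseteq I_r^a$. If $m<r$, then $I_m^a=\langle E_a(D_m^a)\rangle_a$ is generated by the idempotents in its top $\mathscr D^a$-class, and $$\operatorname{rank}(I_m^a)=\operatorname{idrank}(I_m^a)=\begin{cases}m^{n-r}S(r,m)&\text{if }1<m<r\\ n&\text{if }m=1.\end{cases}$$
   Context: $\mathcal T_X$ is the full transformation semigroup of all maps $X\to X$ under composition; maps are written on the right and composed from left to right; for $f\in\mathcal T_X$, $\operatorname{rank}(f)=|\operatorname{im}(f)|$. The variant $\mathcal T_X^a$ is the semigroup with underlying set $\mathcal T_X$ and operation $f\star g=fag$. $P=\operatorname{Reg}(\mathcal T_X^a)=\{f\in\mathcal T_X:\operatorname{rank}(afa)=\operatorname{rank}(f)\}$ is its set of regular elements, a subsemigroup of $\mathcal T_X^a$ (with operation $\star$). $D_j^a=\{f\in P:\operatorname{rank}(f)=j\}$ for $1\le j\le r$; these are the $\mathscr D$-classes ($\mathscr D^a$-classes) of $P$. Ideals are two-sided and (as usual) non-empty. For $U\subseteq\mathcal T_X$, $E_a(U)=\{f\in U:f=f\star f\}$ and $\langle U\rangle_a$ is the subsemigroup of $\mathcal T_X^a$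 generated by $U$. For a semigroup $S$, $\operatorname{rank}(S)$ is the least cardinality of a subset generating $S$ as a semigroup; if $S$ is generated by idempotents, $\operatorname{idrank}(S)$ is the least cardinality of a set of idempotents generating $S$. $S(r,m)$ is the Stirling number of the second kind. *)

theory Defs
  imports Main "HOL-Combinatorics.Stirling"
begin

text \<open>
  A semigroup is given by a multiplication \<open>f\<close> together with a carrier closed under it.
\<close>

inductive_set gen :: "('s \<Rightarrow> 's \<Rightarrow> 's) \<Rightarrow> 's set \<Rightarrow> 's set"
  for f :: "'s \<Rightarrow> 's \<Rightarrow> 's" and U :: "'s set" where
  base: "x \<in> U \<Longrightarrow> x \<in> gen f U"
| mult: "x \<in> gen f U \<Longrightarrow> y \<in> gen f U \<Longrightarrow> f x y \<in> gen f U"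

definition is_ideal :: "('s \<Rightarrow> 's \<Rightarrow> 's) \<Rightarrow> 's set \<Rightarrow> 's set \<Rightarrow> bool" where
  "is_ideal f S I \<longleftrightarrow> I \<noteq> {} \<and> I \<subseteq> S \<and> (\<forall>x\<in>I. \<forall>s\<in>S. f s x \<in> I \<and> f x s \<in> I)"

definition idempotents :: "('s \<Rightarrow> 's \<Rightarrow> 's) \<Rightarrow> 's set \<Rightarrow> 's set" where
  "idempotents f U = {x \<in> U. x = f x x}"

definition regular_elements :: "('s \<Rightarrow> 's \<Rightarrow> 's) \<Rightarrow> 's set \<Rightarrow> 's set" where
  "regular_elements f S = {x \<in> S. \<exists>y\<in>S. x = f (f x y) x}"

text \<open>
  The two ranks are meaningful for semigroups that possess a finite generating set
  (respectively a finite generating set of idempotents); otherwise \<open>LEAST\<close> is unspecified.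
\<close>

definition sg_rank :: "('s \<Rightarrow> 's \<Rightarrow> 's) \<Rightarrow> 's set \<Rightarrow> nat" where
  "sg_rank f S = (LEAST k. \<exists>U. finite U \<and> U \<subseteq> S \<and> card U = k \<and> gen f U = S)"

definition sg_idrank :: "('s \<Rightarrow> 's \<Rightarrow> 's) \<Rightarrow> 's set \<Rightarrow> nat" where
  "sg_idrank f S =
     (LEAST k. \<exists>U. finite U \<and> U \<subseteq> idempotents f S \<and> card U = k \<and> gen f U = S)"

text \<open>
  The finite set \<open>X\<close> is the universe of a type \<open>'x\<close> of class \<open>finite\<close>, so that
  the full transformation semigroup is the type \<open>'x \<Rightarrow> 'x\<close>.
\<close>

definition map_rank :: "('x \<Rightarrow> 'x) \<Rightarrow> nat" where
  "map_rank f = card (range f)"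

text \<open>
  Maps act on the right in the source, so the product \<open>fag\<close> applies \<open>f\<close> first.
\<close>

definition star :: "('x \<Rightarrow> 'x) \<Rightarrow> ('x \<Rightarrow> 'x) \<Rightarrow> ('x \<Rightarrow> 'x) \<Rightarrow> ('x \<Rightarrow> 'x)" where
  "star a f g = g \<circ> a \<circ> f"

definition P_reg :: "('x \<Rightarrow> 'x) \<Rightarrow> ('x \<Rightarrow> 'x) set" where
  "P_reg a = regular_elements (star a) UNIV"

definition D_cls :: "('x \<Rightarrow> 'x) \<Rightarrow> nat \<Rightarrow> ('x \<Rightarrow> 'x) set" where
  "D_cls a j = {f \<in> P_reg a. map_rank f = j}"

definition I_low :: "('x \<Rightarrow> 'x) \<Rightarrow> nat \<Rightarrow> ('x \<Rightarrow> 'x) set" where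
  "I_low a m = (\<Union>j\<in>{1..m}. D_cls a j)"

lemma P_reg_eq_rank:
  fixes a :: "'x::finite \<Rightarrow> 'x"
  shows "P_reg a = {f. map_rank (a \<circ> f \<circ> a) = map_rank f}"
proof (intro set_eqI iffI)
  fix f assume "f \<in> P_reg a"
  then obtain g where g: "f = star a (star a f g) f"
    by (auto simp: P_reg_def regular_elements_def)
  have 1: "f x = f (a (g (a (f x))))" for x
    using fun_cong[OF g, of x] by (simp add: star_def)
  have "f x = (f \<circ> a \<circ> g) ((a \<circ> f \<circ> a) (g (a (f x))))" for x
    using 1[of x] 1[of "a (g (a (f x)))"] by simp
  then have "range f \<subseteq> (f \<circ> a \<circ> g) ` range (a \<circ> f \<circ> a)"
    by blast
  then have "card (range f) \<le> card (range (a \<circ> f \<circ> a))"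
    by (rule surj_card_le[rotated]) simp
  moreover have "range (a \<circ> f \<circ> a) \<subseteq> a ` range f" by auto
  then have "card (range (a \<circ> f \<circ> a)) \<le> card (range f)"
    by (rule surj_card_le[rotated]) simp
  ultimately show "f \<in> {f. map_rank (a \<circ> f \<circ> a) = map_rank f}"
    by (simp add: map_rank_def)
next
  fix f assume "f \<in> {f. map_rank (a \<circ> f \<circ> a) = map_rank f}"
  then have eq: "card (range (a \<circ> f \<circ> a)) = card (range f)"
    by (simp add: map_rank_def)
  have "range (a \<circ> f \<circ> a) = a ` range (f \<circ> a)" by auto
  then have "card (range f) \<le> card (range (f \<circ> a))"
    using card_image_le[of "range (f \<circ> a)" a] eq by simp
  then have im: "range (f \<circ> a) = range f"
    by (intro card_seteq) auto
  have "card (a ` range f) = card (range f)"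
    using eq \<open>range (a \<circ> f \<circ> a) = a ` range (f \<circ> a)\<close> im by simp
  then have inj: "inj_on a (range f)"
    by (intro eq_card_imp_inj_on) auto
  have "\<exists>x. \<forall>y\<in>range f. z = a y \<longrightarrow> f (a x) = y" for z
  proof (cases "z \<in> a ` range f")
    case True
    then obtain y where y: "y \<in> range f" "z = a y" by blast
    with im obtain x where "f (a x) = y" by (metis comp_apply imageE)
    with y inj show ?thesis by (metis inj_onD)
  qed auto
  then obtain g where "\<And>z y. y \<in> range f \<Longrightarrow> z = a y \<Longrightarrow> f (a (g z)) = y"
    by metis
  then have "f = star a (star a f g) f"
    by (auto simp: star_def fun_eq_iff)
  then show "f \<in> P_reg a"
    by (auto simp: P_reg_def regular_elements_def)
qed

end

theory Submission
  imports Defs "HOL-Combinatorics.Cycles"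
begin

text \<open>
  Write \<open>A\<close> for the image of the idempotent \<open>a\<close>, \<open>r\<close> for its size and \<open>n\<close> for that of the whole
  space. A map \<open>f\<close> is regular in the variant iff \<open>f\<close> maps \<open>A\<close> onto its whole image and \<open>a\<close> is
  injective on that image (\<open>P_iff\<close>): the kernel of \<open>f\<close> is a partition all of whose blocks meet \<open>A\<close>,
  and the image of \<open>f\<close> is a partial transversal of the kernel of \<open>a\<close>. If \<open>g\<close> is regular of rank at
  most that of a regular \<open>f\<close>, then \<open>g\<close> factors through \<open>f\<close> (\<open>factor_through\<close>); hence an ideal is
  determined by the largest rank occurring in it.

  Generation. Let \<open>m < r\<close>. An idempotent of rank \<open>m\<close> can move one point of a subset of \<open>A\<close> of size
  at most \<open>m\<close> to any other point of \<open>A\<close> while fixing the remaining points of the subset. As there is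
  always a vacant point of \<open>A\<close>, such moves compose to an arbitrary map from the subset into \<open>A\<close>
  (\<open>generated_maps_realise\<close>). Composing on the left with an idempotent that collapses the space
  along a partition finer than \<open>ker f\<close>, and on the right with an idempotent whose image contains
  that of \<open>f\<close>, yields every regular \<open>f\<close> of rank at most \<open>m\<close>.

  Rank, \<open>1 < m < r\<close>. A factorization of a map of rank \<open>m\<close> into maps of rank at most \<open>m\<close> has a first
  factor with the same kernel. So a generating set has at least as many elements as there are
  kernels, and there are \<open>m ^ (n - r) * Stirling r m\<close> of these: partition \<open>A\<close> into \<open>m\<close> blocks and
  put every other point into one of the blocks. Conversely it suffices to choose one idempotent
  \<open>e\<^sub>K\<close> for each kernel \<open>K\<close> in such a way that for any \<open>K\<close> and any image \<open>Y\<close> some product of chosen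
  idempotents has kernel \<open>K\<close> and image \<open>Y\<close>: if \<open>d\<close> is an idempotent with kernel \<open>K\<close> and image \<open>Y\<close>,
  this product lies in the finite group with identity \<open>d\<close>, so \<open>d\<close> is one of its powers
  (\<open>idempotent_power\<close>).

  For the choice, arrange \<open>A\<close> in a cycle. An \<open>m\<close>-subset \<open>B\<close> of \<open>A\<close> cuts the cycle into the \<open>m\<close> arcs
  that end in the points of \<open>B\<close>, and for \<open>m > 1\<close> these arcs determine \<open>B\<close>. For an image \<open>Y\<close>, the
  partition of \<open>A\<close> into the arcs of \<open>a ` Y\<close> is extended to the whole space so that \<open>Y\<close> can be
  recovered from it, and \<open>e\<^sub>K\<close> has image \<open>Y\<close> if \<open>K\<close> is the resulting partition; for all other kernels
  the choice of \<open>e\<^sub>K\<close> is arbitrary. If \<open>B'\<close> arises from \<open>B\<close> by moving one point to a vacant next place,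
  then \<open>B\<close> is a transversal of the arcs of \<open>B'\<close>, so a product with image over \<open>B\<close> can be continued to
  one with image \<open>B'\<close> and the same kernel. By such moves every \<open>m\<close>-subset of the cycle can be turned
  into every other (\<open>shift_steps_strongly_connected\<close>).
\<close>

section \<open>Counting partitions whose blocks meet a given set\<close>

lemma card_exchange:
  assumes "finite S" "i \<in> S" "j \<notin> S - {i}"
  shows "card (insert j (S - {i})) = card S"
  using assms by (metis card_Suc_Diff1 card_insert_disjoint finite_Diff)

text \<open>
  The partitions of \<open>S\<close> into \<open>k\<close> blocks each of which meets \<open>A\<close>. Neither \<open>S\<close> nor \<open>A\<close> is required to
  contain the other.
\<close>

definition meeting_partitions :: "'a set \<Rightarrow> 'a set \<Rightarrow> nat \<Rightarrow> 'a set set set" where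
  "meeting_partitions S A k = {P. partition_on S P \<and> card P = k \<and> (\<forall>p\<in>P. p \<inter> A \<noteq> {})}"

lemma finite_meeting_partitions: "finite S \<Longrightarrow> finite (meeting_partitions S A k)"
  unfolding meeting_partitions_def
  by (rule finite_subset[OF _ finitely_many_partition_on]) auto

text \<open>
  Removing a new point \<open>x\<close> from a partition of \<open>insert x S\<close> leaves a partition of \<open>S\<close> together with the
  block that contained \<open>x\<close>. The conditions on \<open>Q\<close> say that the remnant of this block is non-empty
  and that all blocks still meet \<open>A\<close> without the help of \<open>x\<close>.
\<close>

lemma card_enlarged_block_partitions:
  assumes fin: "finite S" and x: "x \<notin> S"
  shows "card {Q \<in> meeting_partitions (insert x S) A k. {x} \<notin> Q \<and> (\<forall>q\<in>Q. (q - {x}) \<inter> A \<noteq> {})}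
    = k * card (meeting_partitions S A k)"
proof -
  let ?M = "meeting_partitions S A k"
  let ?R = "{Q \<in> meeting_partitions (insert x S) A k. {x} \<notin> Q \<and> (\<forall>q\<in>Q. (q - {x}) \<inter> A \<noteq> {})}"
  let ?up = "\<lambda>(P, p). insert (insert x p) (P - {p})"
  have xP: "x \<notin> q" if "P \<in> ?M" "q \<in> P" for P q
    using that x by (auto simp: meeting_partitions_def partition_on_def)
  have disj: "q = q'" if "P \<in> ?M" "q \<in> P" "q' \<in> P" "y \<in> q" "y \<in> q'" for P q q' y
    using that by (auto simp: meeting_partitions_def partition_on_def disjoint_def)
  have finP: "finite P" if "P \<in> ?M" for P
    using that fin finite_elements by (auto simp: meeting_partitions_def)
  have "bij_betw ?up (SIGMA P:?M. P) ?R"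
    unfolding bij_betw_def
  proof (intro conjI inj_onI set_eqI iffI)
    fix u v assume u: "u \<in> (SIGMA P:?M. P)" and v: "v \<in> (SIGMA P:?M. P)" and eq: "?up u = ?up v"
    obtain P p where up: "u = (P, p)" "P \<in> ?M" "p \<in> P" using u by auto
    obtain Q q where vq: "v = (Q, q)" "Q \<in> ?M" "q \<in> Q" using v by auto
    have eq': "insert (insert x p) (P - {p}) = insert (insert x q) (Q - {q})"
      using eq up vq by simp
    have nP: "\<And>y. y \<in> P \<Longrightarrow> x \<notin> y" and nQ: "\<And>y. y \<in> Q \<Longrightarrow> x \<notin> y"
      using xP up vq by blast+
    have "insert x p \<in> insert (insert x q) (Q - {q})" using eq' by blast
    then have "insert x p = insert x q" using nQ by blast
    then have pq: "p = q" using insert_ident[OF nP[OF up(3)] nQ[OF vq(3)]] by simp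
    have "insert x p \<notin> P - {p}" "insert x p \<notin> Q - {q}" using nP nQ by blast+
    then have "P - {p} = Q - {q}" using eq' unfolding pq by (simp add: insert_ident)
    then have "P = Q" using up(3) vq(3) pq by (metis insert_Diff)
    then show "u = v" using up vq pq by simp
  next
    fix Q assume "Q \<in> ?up ` (SIGMA P:?M. P)"
    then obtain P p where P: "P \<in> ?M" "p \<in> P" and Q: "Q = insert (insert x p) (P - {p})"
      by auto
    have nP: "\<And>y. y \<in> P \<Longrightarrow> x \<notin> y" using xP P by blast
    have UP: "\<Union>P = S" and ne: "{} \<notin> P" and cP: "card P = k" and mP: "\<forall>q\<in>P. q \<inter> A \<noteq> {}"
      using P by (auto simp: meeting_partitions_def partition_on_def)
    have "insert x p \<notin> P - {p}" using nP by blast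
    then have "card Q = k"
      using Q card_exchange[OF finP[OF P(1)] P(2)] cP by simp
    moreover have "\<Union>Q = insert x S" unfolding Q UP[symmetric] using P(2) by auto
    moreover have dP: "disjoint (P - {p})"
      using P by (auto simp: meeting_partitions_def partition_on_def disjoint_def)
    have "disjnt (insert x p) y" if "y \<in> P - {p}" for y
      using that nP disj[OF P(1) P(2), of y] by (auto simp: disjnt_def)
    then have "disjoint Q"
      unfolding Q pairwise_insert using dP by (simp add: disjnt_sym)
    moreover have "{} \<notin> Q" unfolding Q using ne by simp
    moreover have "q - {x} = q" if "q \<in> P" for q using nP[OF that] by simp
    then have "\<forall>q\<in>Q. (q - {x}) \<inter> A \<noteq> {}"
      unfolding Q using mP P(2) by simp
    moreover have "{x} \<notin> Q"
      unfolding Q using nP ne P(2) by (auto dest: subset_singletonD)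
    ultimately show "Q \<in> ?R"
      by (simp add: meeting_partitions_def partition_on_def) blast
  next
    fix Q assume Q: "Q \<in> ?R"
    have UQ: "\<Union>Q = insert x S" and ne: "{} \<notin> Q" and cQ: "card Q = k" and dQ: "disjoint Q"
      and mQ: "\<forall>q\<in>Q. (q - {x}) \<inter> A \<noteq> {}" and sQ: "{x} \<notin> Q"
      using Q by (auto simp: meeting_partitions_def partition_on_def)
    have finQ: "finite Q" using UQ fin by (metis finite_UnionD finite_insert)
    obtain q where q: "q \<in> Q" "x \<in> q" using UQ by blast
    have other: "x \<notin> y" if "y \<in> Q - {q}" for y
      using that q dQ by (auto simp: disjoint_def)
    have disjQ: "y = z" if "y \<in> Q" "z \<in> Q" "w \<in> y" "w \<in> z" for y z w
      using that dQ by (auto simp: disjoint_def)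
    let ?P = "insert (q - {x}) (Q - {q})"
    have qne: "q - {x} \<noteq> {}" using q sQ by (metis Diff_eq_empty_iff subset_singletonD empty_iff)
    have qn: "q - {x} \<notin> Q - {q}"
      using qne q disjQ by blast
    have "partition_on S ?P"
    proof (rule partition_onI)
      have "\<Union>?P = \<Union>Q - {x}" using q other by blast
      then show "\<Union>?P = S" using UQ x by simp
      show "{} \<notin> ?P" using qne ne by blast
      fix y z assume "y \<in> ?P" "z \<in> ?P" "y \<noteq> z"
      then show "disjnt y z" unfolding disjnt_def using disjQ q by blast
    qed
    moreover have "card ?P = k" using card_exchange[OF finQ q(1) qn] cQ by simp
    moreover have "\<forall>p\<in>?P. p \<inter> A \<noteq> {}" using mQ q by blast
    ultimately have "?P \<in> ?M" by (simp add: meeting_partitions_def)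
    moreover have "?P - {q - {x}} = Q - {q}" using qn by blast
    then have "?up (?P, q - {x}) = Q" using q by (auto simp: insert_absorb)
    ultimately show "Q \<in> ?up ` (SIGMA P:?M. P)"
      by (intro image_eqI[of _ _ "(?P, q - {x})"]) auto
  qed
  then have "card ?R = card (SIGMA P:?M. P)"
    by (simp add: bij_betw_same_card)
  also have "\<dots> = (\<Sum>P\<in>?M. card P)"
    using fin finP by (simp add: finite_meeting_partitions card_SigmaI)
  also have "\<dots> = k * card ?M"
    by (simp add: meeting_partitions_def)
  finally show ?thesis .
qed

lemma card_meeting_partitions_insert_outside:
  assumes "finite S" "x \<notin> S" "x \<notin> A"
  shows "card (meeting_partitions (insert x S) A k) = k * card (meeting_partitions S A k)"
proof -
  have "{Q \<in> meeting_partitions (insert x S) A k. {x} \<notin> Q \<and> (\<forall>q\<in>Q. (q - {x}) \<inter> A \<noteq> {})}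
    = meeting_partitions (insert x S) A k"
    using assms(3) by (fastforce simp: meeting_partitions_def)
  with card_enlarged_block_partitions[OF assms(1,2), of A k] show ?thesis by simp
qed

text \<open>
  Both summands of the recursion for Stirling numbers of the second kind: the new point either joins
  a block or forms a block of its own.
\<close>

lemma card_meeting_partitions_insert_inside:
  assumes fin: "finite S" and x: "x \<notin> S" and sub: "insert x S \<subseteq> A"
  shows "card (meeting_partitions (insert x S) A (Suc k))
    = Suc k * card (meeting_partitions S A (Suc k)) + card (meeting_partitions S A k)"
proof -
  let ?M = "meeting_partitions (insert x S) A (Suc k)"
  have "{Q \<in> ?M. {x} \<notin> Q} = {Q \<in> ?M. {x} \<notin> Q \<and> (\<forall>q\<in>Q. (q - {x}) \<inter> A \<noteq> {})}"
  proof (intro Collect_cong conj_cong refl iffI conjI ballI)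
    fix Q q assume Q: "Q \<in> ?M" "{x} \<notin> Q" and q: "q \<in> Q"
    then have "q \<subseteq> insert x S" "q \<noteq> {}" "q \<noteq> {x}"
      by (auto simp: meeting_partitions_def partition_on_def)
    then show "(q - {x}) \<inter> A \<noteq> {}" using sub by blast
  qed auto
  then have 1: "card {Q \<in> ?M. {x} \<notin> Q} = Suc k * card (meeting_partitions S A (Suc k))"
    using card_enlarged_block_partitions[OF fin x, of A "Suc k"] by simp
  have "bij_betw (insert {x}) (meeting_partitions S A k) {Q \<in> ?M. {x} \<in> Q}"
  proof (intro bij_betw_imageI inj_onI)
    fix P Q assume "P \<in> meeting_partitions S A k" "Q \<in> meeting_partitions S A k"
      and eq: "insert {x} P = insert {x} Q"
    then have "{x} \<notin> P" "{x} \<notin> Q" using x by (auto simp: meeting_partitions_def partition_on_def)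
    then show "P = Q" using eq by (simp add: insert_ident)
  next
    show "insert {x} ` meeting_partitions S A k = {Q \<in> ?M. {x} \<in> Q}"
    proof (intro set_eqI iffI)
      fix Q assume "Q \<in> insert {x} ` meeting_partitions S A k"
      then obtain P where P: "P \<in> meeting_partitions S A k" and Q: "Q = insert {x} P" by blast
      have xP: "disjnt {x} (\<Union>P)" "{x} \<notin> P" and part: "partition_on S P"
        using P x by (auto simp: meeting_partitions_def partition_on_def)
      have "finite P" using finite_elements[OF fin part] .
      then have "card Q = Suc k" using Q xP P by (simp add: meeting_partitions_def)
      moreover have "partition_on (insert x S) Q"
        unfolding Q partition_on_insert[OF xP(1)] using part x by simp
      ultimately show "Q \<in> {Q \<in> ?M. {x} \<in> Q}"
        using Q P sub by (auto simp: meeting_partitions_def)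
    next
      fix Q assume Q: "Q \<in> {Q \<in> ?M. {x} \<in> Q}"
      then have part: "partition_on (insert x S) Q" by (simp add: meeting_partitions_def)
      have "finite Q" using finite_elements[OF _ part] fin by simp
      then have c: "card (Q - {{x}}) = k" using Q by (simp add: meeting_partitions_def)
      have "disjoint Q" "{x} \<in> Q" using part Q by (simp_all add: partition_on_def)
      then have "y \<inter> {x} = {}" if "y \<in> Q - {{x}}" for y
        using that disjointD[of Q y "{x}"] by simp
      then have "disjnt {x} (\<Union>(Q - {{x}}))" by (auto simp: disjnt_def)
      moreover have ins: "insert {x} (Q - {{x}}) = Q" using Q by (simp add: insert_absorb)
      ultimately have "partition_on (insert x S - {x}) (Q - {{x}})"
        using partition_on_insert[of "{x}" "Q - {{x}}" "insert x S"] part by simp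
      then have "Q - {{x}} \<in> meeting_partitions S A k"
        using c Q x by (simp add: meeting_partitions_def)
      then show "Q \<in> insert {x} ` meeting_partitions S A k" using ins by (intro image_eqI[of _ _ "Q - {{x}}"]) simp_all
    qed
  qed
  then have 2: "card {Q \<in> ?M. {x} \<in> Q} = card (meeting_partitions S A k)"
    by (simp add: bij_betw_same_card)
  have finM: "finite ?M" using fin by (simp add: finite_meeting_partitions)
  have "?M = {Q \<in> ?M. {x} \<notin> Q} \<union> {Q \<in> ?M. {x} \<in> Q}" by blast
  then have "card ?M = card ({Q \<in> ?M. {x} \<notin> Q} \<union> {Q \<in> ?M. {x} \<in> Q})" by simp
  also have "\<dots> = card {Q \<in> ?M. {x} \<notin> Q} + card {Q \<in> ?M. {x} \<in> Q}"
    using finM by (intro card_Un_disjoint) auto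
  finally show ?thesis using 1 2 by simp
qed

lemma card_meeting_partitions_inside:
  assumes "finite S" "S \<subseteq> A"
  shows "card (meeting_partitions S A k) = Stirling (card S) k"
  using assms
proof (induction S arbitrary: k rule: finite_induct)
  case empty
  have "meeting_partitions {} A k = (if k = 0 then {{}} else {})"
    by (auto simp: meeting_partitions_def partition_on_empty)
  then show ?case by (cases k) auto
next
  case (insert x S)
  show ?case
  proof (cases k)
    case 0
    have "meeting_partitions (insert x S) A 0 = {}"
    proof (rule ccontr)
      assume "meeting_partitions (insert x S) A 0 \<noteq> {}"
      then obtain P where P: "partition_on (insert x S) P" "card P = 0"
        by (auto simp: meeting_partitions_def)
      then have "P = {}" using finite_elements[OF _ P(1)] insert.hyps by simp
      then show False using P by (simp add: partition_on_def)
    qed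
    then show ?thesis using 0 insert.hyps by simp
  next
    case (Suc j)
    then show ?thesis
      using card_meeting_partitions_insert_inside[OF insert.hyps insert.prems, of j] insert by simp
  qed
qed

lemma card_meeting_partitions:
  assumes "finite T" "finite A" "T \<inter> A = {}"
  shows "card (meeting_partitions (T \<union> A) A k) = k ^ card T * Stirling (card A) k"
  using assms
proof (induction T rule: finite_induct)
  case empty
  then show ?case by (simp add: card_meeting_partitions_inside)
next
  case (insert x T)
  then show ?case
    using card_meeting_partitions_insert_outside[of "T \<union> A" x A k] by simp
qed

section \<open>Moving the points of a subset around a cycle\<close>

text \<open>
  The map \<open>c\<close> permutes the finite set \<open>A\<close> in a single cycle. The cycle is presented by a periodic
  enumeration \<open>\<phi>\<close> of \<open>A\<close>; the values of \<open>c\<close> outside \<open>A\<close> are arbitrary.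
\<close>

definition full_cycle :: "('a \<Rightarrow> 'a) \<Rightarrow> 'a set \<Rightarrow> bool" where
  "full_cycle c A \<longleftrightarrow> (\<exists>\<phi>. inj_on \<phi> {..<card A} \<and> A = \<phi> ` {..<card A} \<and>
     (\<forall>i. \<phi> (i + card A) = \<phi> i) \<and> (\<forall>i. c (\<phi> i) = \<phi> (Suc i)))"

lemma full_cycle_exists:
  assumes fin: "finite A" and ne: "A \<noteq> {}"
  shows "\<exists>c. full_cycle c A"
proof -
  let ?r = "card A"
  have r: "0 < ?r" using fin ne by (simp add: card_gt_0_iff)
  obtain e where "bij_betw e {0..<?r} A" using ex_bij_betw_nat_finite[OF fin] by blast
  then have e: "inj_on e {..<?r}" "A = e ` {..<?r}"
    by (simp_all add: bij_betw_def lessThan_atLeast0)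
  define \<phi> where "\<phi> i = e (i mod ?r)" for i
  define c where "c x = \<phi> (Suc (inv_into {..<?r} e x))" for x
  have low: "\<phi> i = e i" if "i \<in> {..<?r}" for i using that by (simp add: \<phi>_def)
  have "c (\<phi> i) = \<phi> (Suc i)" for i
  proof -
    have "inv_into {..<?r} e (\<phi> i) = i mod ?r"
      using inv_into_f_f[OF e(1)] r by (simp add: \<phi>_def)
    then show ?thesis by (simp add: c_def \<phi>_def mod_Suc_eq)
  qed
  moreover have "inj_on \<phi> {..<?r}" using e(1) low inj_on_cong[of "{..<?r}" \<phi> e] by blast
  moreover have "A = \<phi> ` {..<?r}" using e(2) low by (simp cong: image_cong_simp)
  moreover have "\<phi> (i + ?r) = \<phi> i" for i by (simp add: \<phi>_def)
  ultimately have "full_cycle c A" unfolding full_cycle_def by (intro exI[of _ \<phi>]) simp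
  then show ?thesis by blast
qed

lemma full_cycle_closed:
  assumes "full_cycle c A" "x \<in> A"
  shows "c x \<in> A"
proof -
  obtain \<phi> where inj: "inj_on \<phi> {..<card A}" and A: "A = \<phi> ` {..<card A}"
    and per: "\<And>i. \<phi> (i + card A) = \<phi> i" and nxt: "\<And>i. c (\<phi> i) = \<phi> (Suc i)"
    using assms(1) unfolding full_cycle_def by metis
  obtain i where i: "i < card A" "x = \<phi> i" using A assms(2) by blast
  show ?thesis
  proof (cases "Suc i < card A")
    case True
    then show ?thesis using A i nxt by (metis imageI lessThan_iff)
  next
    case False
    then have "Suc i = 0 + card A" using i by simp
    then have "c x = \<phi> 0" using per[of 0] nxt i by metis
    then show ?thesis using A i by (metis imageI lessThan_iff gr_zeroI not_less_zero)
  qed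
qed

lemma full_cycle_transitive:
  assumes "full_cycle c A" "x \<in> A" "y \<in> A"
  shows "\<exists>k. (c ^^ k) x = y"
proof -
  obtain \<phi> where inj: "inj_on \<phi> {..<card A}" and A: "A = \<phi> ` {..<card A}"
    and per: "\<And>i. \<phi> (i + card A) = \<phi> i" and nxt: "\<And>i. c (\<phi> i) = \<phi> (Suc i)"
    using assms(1) unfolding full_cycle_def by metis
  obtain i where i: "i < card A" "x = \<phi> i" using A assms(2) by blast
  obtain j where j: "j < card A" "y = \<phi> j" using A assms(3) by blast
  have "(c ^^ k) (\<phi> i) = \<phi> (i + k)" for k
    by (induction k) (simp_all add: nxt)
  from this[of "j + card A - i"] have "(c ^^ (j + card A - i)) x = \<phi> (j + card A)"
    using i by simp
  then show ?thesis using per j by metis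
qed

text \<open>
  One point of \<open>B\<close> moves along \<open>c\<close> to the next place, which has to be vacant.
\<close>

definition shift_step :: "('a \<Rightarrow> 'a) \<Rightarrow> 'a set \<Rightarrow> 'a set \<Rightarrow> bool" where
  "shift_step c B B' \<longleftrightarrow> (\<exists>x\<in>B. c x \<notin> B \<and> B' = insert (c x) (B - {x}))"

text \<open>
  The same kind of move on \<open>{..<r}\<close>, where no point passes from \<open>r - 1\<close> to \<open>0\<close>.
\<close>

definition up_step :: "nat \<Rightarrow> nat set \<Rightarrow> nat set \<Rightarrow> bool" where
  "up_step r S S' \<longleftrightarrow> (\<exists>i\<in>S. Suc i \<notin> S \<and> Suc i < r \<and> S' = insert (Suc i) (S - {i}))"

lemma up_steps_to_top:
  assumes "S \<subseteq> {..<r}" "card S = m"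
  shows "(up_step r)\<^sup>*\<^sup>* S {r - m..<r}"
  using assms
proof (induction "\<Sum>i\<in>S. r - i" arbitrary: S rule: less_induct)
  case less
  have fin: "finite S" using less.prems finite_subset by blast
  show ?case
  proof (cases "\<exists>i\<in>S. Suc i \<notin> S \<and> Suc i < r")
    case True
    then obtain i where i: "i \<in> S" "Suc i \<notin> S" "Suc i < r" by blast
    let ?S = "insert (Suc i) (S - {i})"
    have "(\<Sum>j\<in>S. r - j) = (r - i) + (\<Sum>j\<in>S - {i}. r - j)"
      using i fin by (simp add: sum.remove)
    moreover have "(\<Sum>j\<in>?S. r - j) = (r - Suc i) + (\<Sum>j\<in>S - {i}. r - j)"
      using i fin by (subst sum.insert) auto
    ultimately have "(\<Sum>j\<in>?S. r - j) < (\<Sum>j\<in>S. r - j)" using i by simp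
    moreover have "?S \<subseteq> {..<r}" using less.prems i by auto
    moreover have "card ?S = m" using i fin less.prems by (simp only: card_exchange[OF fin i(1)] Diff_iff not_False_eq_True simp_thms)
    ultimately have "(up_step r)\<^sup>*\<^sup>* ?S {r - m..<r}" by (rule less.hyps)
    moreover have "up_step r S ?S" using i by (auto simp: up_step_def)
    ultimately show ?thesis by (rule converse_rtranclp_into_rtranclp[rotated])
  next
    case False
    have up: "j \<in> S" if "i \<in> S" "i \<le> j" "j < r" for i j
      using that(2,1,3)
    proof (induction rule: dec_induct)
      case (step n)
      then have "n \<in> S" "Suc n < r" by simp_all
      then show ?case using False by blast
    qed
    have "S = {r - m..<r}"
    proof (cases "S = {}")
      case True then show ?thesis using less.prems by simp
    next
      case ne: False
      have "S = {Min S..<r}"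
        using up[OF Min_in[OF fin ne]] fin less.prems by auto
      then have "m = r - Min S" using less.prems by (metis card_atLeastLessThan)
      moreover have "Min S < r" using Min_in[OF fin ne] less.prems by auto
      ultimately show ?thesis using \<open>S = {Min S..<r}\<close> by simp
    qed
    then show ?thesis by simp
  qed
qed

lemma up_steps_from_bottom:
  assumes "S \<subseteq> {..<r}" "card S = m"
  shows "(up_step r)\<^sup>*\<^sup>* {..<m} S"
  using assms
proof (induction "\<Sum>S" arbitrary: S rule: less_induct)
  case less
  have fin: "finite S" using less.prems finite_subset by blast
  show ?case
  proof (cases "\<exists>i. Suc i \<in> S \<and> i \<notin> S")
    case True
    then obtain i where i: "Suc i \<in> S" "i \<notin> S" by blast
    let ?S = "insert i (S - {Suc i})"
    have "\<Sum>S = Suc i + \<Sum>(S - {Suc i})"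
      using i fin by (simp add: sum.remove)
    moreover have "\<Sum>?S = i + \<Sum>(S - {Suc i})"
      using i fin by (subst sum.insert) auto
    ultimately have "\<Sum>?S < \<Sum>S" by simp
    moreover have "?S \<subseteq> {..<r}" using less.prems i by auto
    moreover have "card ?S = m" using i fin less.prems by (simp only: card_exchange[OF fin i(1)] Diff_iff not_False_eq_True simp_thms)
    ultimately have "(up_step r)\<^sup>*\<^sup>* {..<m} ?S" by (rule less.hyps)
    moreover have "up_step r ?S S"
      unfolding up_step_def using i less.prems by (intro bexI[of _ i]) auto
    ultimately show ?thesis by simp
  next
    case False
    have down: "j \<in> S" if "i \<in> S" "j \<le> i" for i j
      using that(2,1)
    proof (induction rule: inc_induct)
      case (step n) then show ?case using False by blast
    qed
    have "S = {..<m}"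
    proof (cases "S = {}")
      case True then show ?thesis using less.prems by simp
    next
      case ne: False
      have "S = {..<Suc (Max S)}"
        using down[OF Max_in[OF fin ne]] fin by (auto simp: less_Suc_eq_le)
      then show ?thesis using less.prems by (metis card_lessThan)
    qed
    then show ?thesis by simp
  qed
qed

text \<open>
  Moves that do not cross a chosen base point bring any set to the last \<open>m\<close> places before that point,
  and bring the first \<open>m\<close> places from that point to any set. The last \<open>m\<close> places with respect to one
  base point are the first \<open>m\<close> places with respect to another, so all sets are connected.
\<close>

lemma shift_steps_strongly_connected:
  assumes c: "full_cycle c A"
    and B: "B \<subseteq> A" "card B = m" and C: "C \<subseteq> A" "card C = m"
  shows "(shift_step c)\<^sup>*\<^sup>* B C"
proof -
  obtain \<phi> r where inj: "inj_on \<phi> {..<r}" and A: "A = \<phi> ` {..<r}"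
    and per: "\<And>i. \<phi> (i + r) = \<phi> i" and nxt: "\<And>i. c (\<phi> i) = \<phi> (Suc i)"
    using c unfolding full_cycle_def by metis
  show ?thesis
  proof (cases "r = 0")
    case True
    then have "B = {}" "C = {}" using A B C by auto
    then show ?thesis by simp
  next
    case r: False
    have mod: "\<phi> (i mod r) = \<phi> i" for i
    proof -
      have "\<phi> (j + r * k) = \<phi> j" for j k
      proof (induction k)
        case (Suc k)
        then show ?case using per[of "j + r * k"] by (simp add: algebra_simps)
      qed simp
      from this[of "i mod r" "i div r"] show ?thesis by (simp add: mult.commute)
    qed
    have phi_eq: "\<phi> i = \<phi> j \<longleftrightarrow> i mod r = j mod r" for i j
      using inj_onD[OF inj, of "i mod r" "j mod r"] mod r by (metis lessThan_iff mod_less_divisor neq0_conv)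
    have covers: "A \<subseteq> (\<lambda>i. \<phi> (i + d)) ` {..<r}" for d
    proof -
      let ?f = "\<lambda>i. \<phi> (i + d)"
      have "\<phi> i \<in> ?f ` {..<r}" for i
      proof -
        have "\<phi> ((i + (r - d mod r)) mod r + d) = \<phi> i"
        proof -
          have "((i + (r - d mod r)) mod r + d) mod r = (i + (r - d mod r) + d mod r) mod r"
            by (simp add: mod_simps)
          also have "i + (r - d mod r) + d mod r = i + r"
            using mod_less_divisor[of r d] r by linarith
          finally show ?thesis by (simp add: phi_eq)
        qed
        then show ?thesis using r by (metis imageI lessThan_iff mod_less_divisor neq0_conv)
      qed
      then show ?thesis using A by blast
    qed
    have injd: "inj_on (\<lambda>i. \<phi> (i + d)) {..<r}" for d
    proof (rule eq_card_imp_inj_on)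
      have "r = card A" using A inj by (simp add: card_image)
      also have "\<dots> \<le> card ((\<lambda>i. \<phi> (i + d)) ` {..<r})" using covers by (intro card_mono) auto
      finally show "card ((\<lambda>i. \<phi> (i + d)) ` {..<r}) = card {..<r}"
        using card_image_le[of "{..<r}" "\<lambda>i. \<phi> (i + d)"] by simp
    qed simp
    have lift: "(shift_step c)\<^sup>*\<^sup>* ((\<lambda>i. \<phi> (i + d)) ` S) ((\<lambda>i. \<phi> (i + d)) ` S')"
      if "(up_step r)\<^sup>*\<^sup>* S S'" "S \<subseteq> {..<r}" for S S' d
    proof -
      let ?f = "\<lambda>i. \<phi> (i + d)"
      have "S' \<subseteq> {..<r} \<and> (shift_step c)\<^sup>*\<^sup>* (?f ` S) (?f ` S')"
        using that
      proof (induction rule: rtranclp_induct)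
        case (step T U)
        then have T: "T \<subseteq> {..<r}" by simp
        obtain i where i: "i \<in> T" "Suc i \<notin> T" "Suc i < r" "U = insert (Suc i) (T - {i})"
          using step.hyps(2) by (auto simp: up_step_def)
        have ci: "c (?f i) = ?f (Suc i)" using nxt by simp
        have "?f (Suc i) \<notin> ?f ` T"
          using inj_on_image_mem_iff[OF injd, of "Suc i" T] i T by blast
        moreover have "?f ` U = insert (?f (Suc i)) (?f ` T - {?f i})"
          using i T inj_on_image_set_diff[OF injd, of T "{i}"] by auto
        ultimately have "shift_step c (?f ` T) (?f ` U)"
          unfolding shift_step_def using i(1) ci by (intro bexI[of _ "?f i"]) auto
        moreover have "U \<subseteq> {..<r}" using i T by auto
        ultimately show ?case using step.IH step.prems rtranclp.rtrancl_into_rtrancl by metis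
      qed simp
      then show ?thesis by blast
    qed
    have index: "\<exists>S \<subseteq> {..<r}. card S = m \<and> (\<lambda>i. \<phi> (i + d)) ` S = B"
      if B: "B \<subseteq> A" "card B = m" for B d
    proof -
      let ?f = "\<lambda>i. \<phi> (i + d)"
      obtain S where S: "S \<subseteq> {..<r}" "B = ?f ` S" "inj_on ?f S"
        using B covers[of d] subset_image_inj[of B ?f "{..<r}"] by auto
      then have "card S = m" using B(2) card_image[OF S(3)] by simp
      then show ?thesis using S(1,2) by (intro exI[of _ S]) simp
    qed
    \<comment> \<open>Seen from the base point \<open>\<phi> m\<close>, the set \<open>\<phi> ` {..<m}\<close> occupies the last \<open>m\<close> positions.\<close>
    obtain S where S: "S \<subseteq> {..<r}" "card S = m" "(\<lambda>i. \<phi> (i + m)) ` S = B"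
      using index[OF B, of m] by metis
    have mr: "m \<le> r" using S card_mono[of "{..<r}" S] by simp
    have "(\<lambda>i. \<phi> (i + m)) ` {r - m..<r} = \<phi> ` {..<m}"
    proof -
      have eq: "{r - m..<r} = (\<lambda>i. i + (r - m)) ` {..<m}"
        unfolding lessThan_atLeast0 image_add_atLeastLessThan' using mr by simp
      show ?thesis
        unfolding eq image_image using mr by (simp add: per)
    qed
    then have 1: "(shift_step c)\<^sup>*\<^sup>* B (\<phi> ` {..<m})"
      using lift[OF up_steps_to_top[OF S(1,2)] S(1), of m] S(3) by simp
    obtain T where T: "T \<subseteq> {..<r}" "card T = m" "(\<lambda>i. \<phi> (i + 0)) ` T = C"
      using index[OF C, of 0] by metis
    have "(shift_step c)\<^sup>*\<^sup>* (\<phi> ` {..<m}) C"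
      using lift[OF up_steps_from_bottom[OF T(1,2)], of 0] T(3) mr by simp
    with 1 show ?thesis by (rule rtranclp_trans)
  qed
qed

text \<open>
  The first point of \<open>B\<close> met by iterating \<open>c\<close> from \<open>x\<close>, where \<open>x\<close> itself counts. The fibres of this map on
  a cycle are the arcs ending in the points of \<open>B\<close>. The definition is meaningful only if the orbit of
  \<open>x\<close> meets \<open>B\<close>.
\<close>

definition first_hit :: "('a \<Rightarrow> 'a) \<Rightarrow> 'a set \<Rightarrow> 'a \<Rightarrow> 'a" where
  "first_hit c B x = (c ^^ (LEAST k. (c ^^ k) x \<in> B)) x"

lemma first_hit_in:
  assumes "(c ^^ k) x \<in> B"
  shows "first_hit c B x \<in> B"
  unfolding first_hit_def using assms by (rule LeastI)

lemma first_hit_self [simp]: "x \<in> B \<Longrightarrow> first_hit c B x = x"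
  unfolding first_hit_def by (subst Least_eq_0) auto

lemma first_hit_next:
  assumes "x \<notin> B" "(c ^^ k) x \<in> B"
  shows "first_hit c B (c x) = first_hit c B x"
proof -
  have "(LEAST k. (c ^^ k) x \<in> B) = Suc (LEAST k. (c ^^ Suc k) x \<in> B)"
    using assms by (intro Least_Suc) auto
  then show ?thesis by (simp add: first_hit_def funpow_swap1)
qed

lemma first_hit_next_neq:
  assumes x: "x \<in> B" and y: "y \<in> B" "y \<noteq> x" and hit: "(c ^^ l) x = y"
  shows "first_hit c B (c x) \<noteq> x"
proof
  let ?k = "LEAST k. (c ^^ k) (c x) \<in> B"
  assume eq: "first_hit c B (c x) = x"
  then have per: "(c ^^ Suc ?k) x = x" by (simp add: first_hit_def funpow_swap1)
  let ?j = "l mod Suc ?k"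
  have j: "(c ^^ ?j) x = y" using funpow_mod_eq[OF per, of l] hit by simp
  have "?j \<noteq> 0" using j y(2) by (metis funpow_0)
  then obtain i where i: "?j = Suc i" using not0_implies_Suc by blast
  then have "i < ?k" using mod_less_divisor[of "Suc ?k" l] by simp
  then have "(c ^^ i) (c x) \<notin> B" by (rule not_less_Least)
  then show False using j i y(1) by (simp add: funpow_swap1)
qed

lemma first_hit_mem:
  assumes "full_cycle c A" "x \<in> A" "B \<subseteq> A" "B \<noteq> {}"
  shows "first_hit c B x \<in> B"
proof -
  obtain b where "b \<in> B" using assms(4) by blast
  then obtain k where "(c ^^ k) x \<in> B"
    using full_cycle_transitive[OF assms(1,2), of b] assms(3) by auto
  then show ?thesis by (rule first_hit_in)
qed

text \<open>
  The arcs determine \<open>B\<close>: a point lies in \<open>B\<close> iff an arc ends there. For a singleton \<open>B\<close> there is only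
  one arc, hence the bound on the cardinality.
\<close>

lemma first_hit_eq_next_iff:
  assumes c: "full_cycle c A" and x: "x \<in> A" and B: "B \<subseteq> A" "1 < card B"
  shows "first_hit c B (c x) = first_hit c B x \<longleftrightarrow> x \<notin> B"
proof -
  have "\<not> B \<subseteq> {x}" using B(2) card_mono[of "{x}" B] by auto
  then obtain y where y: "y \<in> B" "y \<noteq> x" by blast
  obtain k where k: "(c ^^ k) x = y" using full_cycle_transitive[OF c x] y B by blast
  show ?thesis
  proof (cases "x \<in> B")
    case True
    then show ?thesis using first_hit_next_neq[OF True y k] by simp
  next
    case False
    then show ?thesis using first_hit_next[where B = B, of x k c] k y by simp
  qed
qed

text \<open>
  The set \<open>B\<close> before a move is a transversal of the arcs of the set \<open>B'\<close> after it.
\<close>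

lemma first_hit_inj_on_shift:
  assumes "shift_step c B B'"
  shows "inj_on (first_hit c B') B"
proof -
  obtain x where x: "x \<in> B" "c x \<notin> B" "B' = insert (c x) (B - {x})"
    using assms by (auto simp: shift_step_def)
  have "x \<notin> B'" using x by auto
  then have "first_hit c B' x = c x"
    using first_hit_next[where B = B', of x 1 c] x by simp
  moreover have "first_hit c B' b = b" if "b \<in> B" "b \<noteq> x" for b
    using that x by simp
  ultimately show ?thesis using x unfolding inj_on_def by metis
qed

section \<open>Generating sets and ranks of semigroups\<close>

lemma gen_subset_closed:
  assumes "U \<subseteq> S" "\<And>x y. x \<in> S \<Longrightarrow> y \<in> S \<Longrightarrow> f x y \<in> S"
  shows "gen f U \<subseteq> S"
proof
  fix x assume "x \<in> gen f U"
  then show "x \<in> S" by induction (use assms in auto)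
qed

lemma gen_absorb: "V \<subseteq> gen f U \<Longrightarrow> gen f V \<subseteq> gen f U"
  by (rule gen_subset_closed) (auto intro: gen.mult)

lemma sg_rank_eqI:
  assumes "finite U" "U \<subseteq> idempotents f S" "gen f U = S" "card U \<le> N"
    and low: "\<And>V. finite V \<Longrightarrow> V \<subseteq> S \<Longrightarrow> gen f V = S \<Longrightarrow> N \<le> card V"
  shows "sg_rank f S = N" "sg_idrank f S = N"
proof -
  have sub: "idempotents f S \<subseteq> S" by (auto simp: idempotents_def)
  then have "U \<subseteq> S" using assms(2) by (rule subset_trans[rotated])
  then have "card U = N" using le_antisym[OF assms(4) low[OF assms(1) _ assms(3)]] by simp
  show "sg_rank f S = N"
    unfolding sg_rank_def
  proof (rule Least_equality)
    show "\<exists>U. finite U \<and> U \<subseteq> S \<and> card U = N \<and> gen f U = S"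
      using assms \<open>U \<subseteq> S\<close> \<open>card U = N\<close> by (intro exI[of _ U]) simp
  next
    fix k assume "\<exists>U. finite U \<and> U \<subseteq> S \<and> card U = k \<and> gen f U = S"
    then show "N \<le> k" using low by metis
  qed
  show "sg_idrank f S = N"
    unfolding sg_idrank_def
  proof (rule Least_equality)
    show "\<exists>U. finite U \<and> U \<subseteq> idempotents f S \<and> card U = N \<and> gen f U = S"
      using assms \<open>card U = N\<close> by (intro exI[of _ U]) simp
  next
    fix k assume "\<exists>U. finite U \<and> U \<subseteq> idempotents f S \<and> card U = k \<and> gen f U = S"
    then show "N \<le> k" using low sub by (metis subset_trans)
  qed
qed

section \<open>Kernels of maps\<close>

text \<open>
  The kernel of a map, given as the partition of its domain into fibres.
\<close>

definition fibres :: "('a \<Rightarrow> 'b) \<Rightarrow> 'a set set" where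
  "fibres f = range (\<lambda>x. f -` {f x})"

lemma fibres_eq_iff: "fibres f = fibres g \<longleftrightarrow> (\<forall>x y. f x = f y \<longleftrightarrow> g x = g y)"
proof
  assume eq: "fibres f = fibres g"
  have same: "f -` {f x} = g -` {g x}" for x
  proof -
    have "f -` {f x} \<in> fibres g" using eq unfolding fibres_def by (metis rangeI)
    then obtain z where z: "f -` {f x} = g -` {g z}" by (auto simp: fibres_def)
    have "x \<in> f -` {f x}" by simp
    then have "g x = g z" unfolding z by simp
    then show ?thesis using z by simp
  qed
  show "\<forall>x y. f x = f y \<longleftrightarrow> g x = g y"
  proof (intro allI)
    fix x y
    have "f x = f y \<longleftrightarrow> y \<in> f -` {f x}" by auto
    also have "\<dots> \<longleftrightarrow> y \<in> g -` {g x}" by (simp only: same)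
    also have "\<dots> \<longleftrightarrow> g x = g y" by auto
    finally show "f x = f y \<longleftrightarrow> g x = g y" .
  qed
next
  assume eq: "\<forall>x y. f x = f y \<longleftrightarrow> g x = g y"
  have "f -` {f x} = g -` {g x}" for x
  proof (rule set_eqI)
    fix y show "y \<in> f -` {f x} \<longleftrightarrow> y \<in> g -` {g x}" using eq[rule_format, of y x] by simp
  qed
  then show "fibres f = fibres g" by (simp add: fibres_def)
qed

lemma card_fibres: "card (fibres f) = map_rank f"
proof -
  have "fibres f = (\<lambda>y. f -` {y}) ` range f" by (auto simp: fibres_def)
  moreover have "inj_on (\<lambda>y. f -` {y}) (range f)"
    by (rule inj_onI) blast
  ultimately show ?thesis by (simp add: card_image map_rank_def)
qed

lemma fibres_eqI:
  fixes f g :: "'x::finite \<Rightarrow> 'x"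
  assumes coarser: "\<And>x y. f x = f y \<Longrightarrow> g x = g y" and "map_rank f \<le> map_rank g"
  shows "fibres f = fibres g"
proof -
  have gk: "g x = g (inv f (f x))" for x
    by (rule coarser) (simp add: f_inv_into_f)
  then have "range g = (\<lambda>z. g (inv f z)) ` range f" by (auto simp: image_image)
  then have "card ((\<lambda>z. g (inv f z)) ` range f) = card (range f)"
    using assms(2) card_image_le[of "range f" "\<lambda>z. g (inv f z)"] by (simp add: map_rank_def)
  then have "inj_on (\<lambda>z. g (inv f z)) (range f)" by (intro eq_card_imp_inj_on) auto
  then have "f x = f y" if "g x = g y" for x y
    using that gk by (metis inj_onD rangeI)
  then show ?thesis using coarser unfolding fibres_eq_iff by metis
qed

section \<open>Regular elements of the variant\<close>

locale idempotent_variant =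
  fixes a :: "'x::finite \<Rightarrow> 'x"
  assumes idem: "a \<circ> a = a"
begin

abbreviation "A \<equiv> range a"
abbreviation "P \<equiv> P_reg a"
abbreviation prod (infixl "\<star>" 70) where "f \<star> g \<equiv> star a f g"

text \<open>
  The idempotents of rank \<open>m\<close>. Idempotents are regular, so membership in \<open>D_cls a m\<close> is no further
  restriction (\<open>E_iff\<close>).
\<close>

abbreviation "E m \<equiv> idempotents (star a) (D_cls a m)"

lemma a_a [simp]: "a (a x) = a x"
  using idem by (metis comp_apply)

lemma a_fix: "x \<in> A \<Longrightarrow> a x = x"
  by auto

lemma a_fix_on: "B \<subseteq> A \<Longrightarrow> x \<in> B \<Longrightarrow> a x = x"
  by (rule a_fix) (rule subsetD)

lemma a_image_id:
  assumes "B \<subseteq> A"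
  shows "a ` B = B"
proof -
  have "a ` B = (\<lambda>x. x) ` B" using assms by (intro image_cong) auto
  then show ?thesis by simp
qed

lemma a_inj_on: "B \<subseteq> A \<Longrightarrow> inj_on a B"
  by (rule inj_onI) (simp add: a_fix_on)

lemma star_apply [simp]: "(f \<star> g) x = g (a (f x))"
  by (simp add: star_def)

lemma range_star: "range (f \<star> g) = g ` a ` range f"
  by auto

lemma P_iff: "f \<in> P \<longleftrightarrow> f ` A = range f \<and> inj_on a (range f)"
proof -
  have im: "range (a \<circ> f \<circ> a) = a ` f ` A" by auto
  have P: "f \<in> P \<longleftrightarrow> card (a ` f ` A) = card (range f)"
    by (simp only: P_reg_eq_rank map_rank_def im mem_Collect_eq)
  have sub: "f ` A \<subseteq> range f" by auto
  show ?thesis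
  proof
    assume "f \<in> P"
    then have c: "card (a ` f ` A) = card (range f)" using P by simp
    have "card (a ` f ` A) \<le> card (f ` A)" by (simp add: card_image_le)
    then have fA: "f ` A = range f"
      using c sub by (intro card_seteq) auto
    then have "inj_on a (range f)" using c by (intro eq_card_imp_inj_on) auto
    with fA show "f ` A = range f \<and> inj_on a (range f)" ..
  next
    assume "f ` A = range f \<and> inj_on a (range f)"
    then show "f \<in> P" unfolding P by (simp add: card_image)
  qed
qed

lemma star_in_P:
  assumes "f \<in> P" "g \<in> P"
  shows "f \<star> g \<in> P"
  unfolding P_iff
proof
  have "(f \<star> g) ` A = g ` a ` f ` A" by (auto simp: image_image)
  then show "(f \<star> g) ` A = range (f \<star> g)"
    using assms(1) by (simp only: range_star P_iff)
  have "range (f \<star> g) \<subseteq> range g" by auto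
  then show "inj_on a (range (f \<star> g))"
    using assms(2) inj_on_subset unfolding P_iff by blast
qed

lemma map_rank_pos: "1 \<le> map_rank f" for f :: "'x \<Rightarrow> 'x"
  unfolding map_rank_def by (simp add: Suc_le_eq card_gt_0_iff)

lemma map_rank_star_left: "map_rank (f \<star> g) \<le> map_rank f"
proof -
  have "range (f \<star> g) = (\<lambda>z. g (a z)) ` range f" by auto
  then show ?thesis unfolding map_rank_def by (metis card_image_le finite)
qed

lemma map_rank_star_right: "map_rank (f \<star> g) \<le> map_rank g"
  unfolding map_rank_def by (intro card_mono) auto

lemma map_rank_le: "f \<in> P \<Longrightarrow> map_rank f \<le> map_rank a"
  unfolding P_iff map_rank_def by (metis card_image card_mono finite image_mono subset_UNIV)

lemma I_low_eq: "I_low a m = {f \<in> P. map_rank f \<le> m}"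
  using map_rank_pos by (auto simp: I_low_def D_cls_def)

lemma I_low_subset_P: "I_low a m \<subseteq> P"
  by (auto simp: I_low_eq)

lemma I_low_star: "f \<in> I_low a m \<Longrightarrow> g \<in> P \<Longrightarrow> f \<star> g \<in> I_low a m"
  using star_in_P order_trans[OF map_rank_star_left[of f g]] unfolding I_low_eq by simp

lemma star_I_low: "f \<in> P \<Longrightarrow> g \<in> I_low a m \<Longrightarrow> f \<star> g \<in> I_low a m"
  using star_in_P order_trans[OF map_rank_star_right[of f g]] unfolding I_low_eq by simp

lemma const_in_P: "(\<lambda>_. x) \<in> P"
  by (auto simp: P_iff)

text \<open>
  A transversal of the kernel of a regular map can be chosen within \<open>A\<close>.
\<close>

lemma transversal:
  assumes "f \<in> P"
  obtains B where "B \<subseteq> A" "inj_on f B" "f ` B = range f" "card B = map_rank f"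
proof -
  have "range f \<subseteq> f ` A" using assms by (simp add: P_iff)
  then obtain B where "B \<subseteq> A" "inj_on f B" "range f = f ` B"
    using subset_image_inj[of "range f" f A] by auto
  then show ?thesis using that card_image unfolding map_rank_def by metis
qed

section \<open>Ideals\<close>

text \<open>
  Here \<open>s\<close> follows \<open>g\<close> by an injection \<open>\<iota>\<close> of the image of \<open>g\<close> into a transversal of \<open>f\<close>, and \<open>t\<close> undoes
  the effect of \<open>\<iota>\<close>, \<open>f\<close> and \<open>a\<close>.
\<close>

lemma factor_through:
  assumes f: "f \<in> P" and g: "g \<in> P" and le: "map_rank g \<le> map_rank f"
  shows "\<exists>s\<in>P. \<exists>t\<in>P. g = s \<star> f \<star> t"
proof -
  obtain B where B: "B \<subseteq> A" "inj_on f B" "f ` B = range f" "card B = map_rank f"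
    using transversal[OF f] .
  have "\<exists>\<iota>. inj_on \<iota> (range g) \<and> \<iota> ` range g \<subseteq> B"
    using le B(4) by (subst inj_on_iff_card_le) (auto simp: map_rank_def)
  then obtain \<iota> where \<iota>: "inj_on \<iota> (range g)" "\<iota> ` range g \<subseteq> B" by blast
  define \<kappa> where "\<kappa> y = a (f (\<iota> y))" for y
  have inj: "inj_on \<kappa> (range g)"
  proof (rule inj_onI)
    fix y z assume yz: "y \<in> range g" "z \<in> range g" "\<kappa> y = \<kappa> z"
    have "inj_on a (range f)" using f by (simp add: P_iff)
    then have "f (\<iota> y) = f (\<iota> z)" using yz(3) unfolding \<kappa>_def by (metis inj_onD rangeI)
    then have "\<iota> y = \<iota> z" using B(2) \<iota>(2) yz by (meson image_subset_iff inj_onD)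
    then show "y = z" using \<iota>(1) yz by (meson inj_onD)
  qed
  define s where "s = \<iota> \<circ> g"
  define t where "t x = (if a x \<in> \<kappa> ` range g then inv_into (range g) \<kappa> (a x) else g x)" for x
  have t: "t (\<kappa> y) = y" if "y \<in> range g" for y
  proof -
    have "a (\<kappa> y) = \<kappa> y" by (simp add: \<kappa>_def)
    then show ?thesis using that inj by (simp add: t_def)
  qed
  have "s \<in> P"
    unfolding P_iff
  proof
    show "s ` A = range s" using g unfolding P_iff s_def by (metis image_comp)
    have "range s \<subseteq> A" using \<iota> B unfolding s_def by auto
    then show "inj_on a (range s)" by (rule a_inj_on)
  qed
  moreover have "t \<in> P"
  proof -
    have "t x \<in> range g" for x by (auto simp: t_def intro: inv_into_into)
    then have 1: "range t \<subseteq> range g" by blast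
    have "\<kappa> y \<in> A" for y by (simp add: \<kappa>_def)
    then have 2: "range g \<subseteq> t ` A" using t by (metis image_eqI subsetI)
    have 3: "t ` A \<subseteq> range t" by blast
    have "range t = range g" "t ` A = range t" using 1 2 3 by auto
    then show ?thesis using g by (simp add: P_iff)
  qed
  moreover have "g = s \<star> f \<star> t"
  proof
    fix x
    have "\<iota> (g x) \<in> A"
      using subsetD[OF \<iota>(2) imageI[OF rangeI]] subsetD[OF B(1)] by simp
    then have "a (\<iota> (g x)) = \<iota> (g x)" by (rule a_fix)
    then have "(s \<star> f \<star> t) x = t (\<kappa> (g x))" by (simp add: s_def \<kappa>_def)
    also have "\<dots> = g x" by (simp add: t)
    finally show "g x = (s \<star> f \<star> t) x" by (rule sym)
  qed
  ultimately show ?thesis by blast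
qed

lemma is_ideal_I_low:
  assumes "1 \<le> m"
  shows "is_ideal (star a) P (I_low a m)"
  unfolding is_ideal_def
proof (intro conjI ballI)
  have "(\<lambda>_. undefined) \<in> I_low a m"
    using const_in_P assms by (simp add: I_low_eq map_rank_def)
  then show "I_low a m \<noteq> {}" by blast
  show "I_low a m \<subseteq> P" by (auto simp: I_low_eq)
qed (simp_all add: I_low_star star_I_low)

lemma ideal_eq_I_low:
  assumes J: "is_ideal (star a) P J"
  shows "\<exists>m. J = I_low a m \<and> 1 \<le> m \<and> m \<le> map_rank a"
proof -
  have JP: "J \<subseteq> P" and ne: "J \<noteq> {}" and cl: "\<And>x s. x \<in> J \<Longrightarrow> s \<in> P \<Longrightarrow> s \<star> x \<in> J \<and> x \<star> s \<in> J"
    using J by (auto simp: is_ideal_def)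
  have fin: "finite (map_rank ` J)" by simp
  have "Max (map_rank ` J) \<in> map_rank ` J" using fin ne by (intro Max_in) auto
  then obtain f where f: "f \<in> J" "map_rank f = Max (map_rank ` J)" by (metis imageE)
  have "J = I_low a (map_rank f)"
  proof (intro equalityI subsetI)
    fix g assume "g \<in> J"
    then show "g \<in> I_low a (map_rank f)" using JP f fin by (auto simp: I_low_eq)
  next
    fix g assume "g \<in> I_low a (map_rank f)"
    then have "g \<in> P" "map_rank g \<le> map_rank f" by (auto simp: I_low_eq)
    then obtain s t where "s \<in> P" "t \<in> P" "g = s \<star> f \<star> t"
      using factor_through f JP by blast
    then show "g \<in> J" using cl f(1) by simp
  qed
  moreover have "f \<in> P" using f JP by blast
  ultimately show ?thesis using map_rank_pos map_rank_le by blast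
qed

section \<open>Generation by idempotents of fixed rank\<close>

lemma E_iff: "f \<in> E m \<longleftrightarrow> f \<star> f = f \<and> map_rank f = m"
proof -
  have "f \<in> P" if "f \<star> f = f"
    using that unfolding P_reg_def regular_elements_def by (intro CollectI conjI bexI[of _ f]) auto
  then show ?thesis by (auto simp: idempotents_def D_cls_def)
qed

lemma E_subset_P: "E m \<subseteq> P"
  by (auto simp: idempotents_def D_cls_def)

text \<open>
  A retraction \<open>\<pi>\<close> onto a subset \<open>V\<close> of \<open>A\<close>, followed by a right inverse \<open>\<tau>\<close> of \<open>a\<close> on \<open>V\<close>, is an
  idempotent of the variant.
\<close>

lemma section_idempotent:
  assumes "V \<subseteq> A" "card V = m" and sec: "\<And>v. v \<in> V \<Longrightarrow> a (\<tau> v) = v"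
    and ret: "\<And>x. \<pi> x \<in> V" "\<And>v. v \<in> V \<Longrightarrow> \<pi> v = v"
  shows "(\<lambda>x. \<tau> (\<pi> x)) \<in> E m" "range (\<lambda>x. \<tau> (\<pi> x)) = \<tau> ` V"
proof -
  have "\<pi> ` UNIV = V" using ret by (metis image_subset_iff subsetI subset_antisym rangeI)
  then show ran: "range (\<lambda>x. \<tau> (\<pi> x)) = \<tau> ` V" by (metis image_image)
  have "inj_on \<tau> V" using sec by (metis inj_onI)
  then have "map_rank (\<lambda>x. \<tau> (\<pi> x)) = m"
    using assms(2) unfolding map_rank_def ran by (simp add: card_image)
  then show "(\<lambda>x. \<tau> (\<pi> x)) \<in> E m"
    unfolding E_iff by (simp add: fun_eq_iff sec ret)
qed

lemma retraction_idempotent: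
  assumes "V \<subseteq> A" "card V = m" "\<And>x. \<pi> x \<in> V" "\<And>v. v \<in> V \<Longrightarrow> \<pi> v = v"
  shows "\<pi> \<in> E m"
  using section_idempotent(1)[OF assms(1,2), of "\<lambda>v. v" \<pi>] assms(3,4) a_fix_on[OF assms(1)]
  by simp

lemma moving_idempotent:
  assumes S: "S \<subseteq> A" "card S \<le> m" and m: "m < card A" and c: "c \<in> S" and b: "b \<in> A" "b \<noteq> c"
  shows "\<exists>g\<in>E m. g c = b \<and> (\<forall>x\<in>S - {c}. g x = x)"
proof -
  have "0 < card S" using c by (auto simp: card_gt_0_iff)
  then have "card (insert b (S - {c})) \<le> card S"
    using card_insert_le_m1[of "card S" "S - {c}" b] c by simp
  then have 1: "card (insert b (S - {c})) \<le> m" using S(2) by simp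
  have 2: "m \<le> card (A - {c})" using m c S(1) by (simp add: card_Diff_singleton subset_iff)
  have 3: "insert b (S - {c}) \<subseteq> A - {c}" using S b by blast
  obtain V where V: "insert b (S - {c}) \<subseteq> V" "V \<subseteq> A - {c}" "card V = m"
    using exists_subset_between[OF 1 2 3] by auto
  let ?g = "\<lambda>x. if x \<in> V then x else b"
  have "?g \<in> E m" using V by (intro retraction_idempotent[of V]) auto
  moreover have "?g c = b" "\<forall>x\<in>S - {c}. ?g x = x" using V by auto
  ultimately show ?thesis by (intro bexI[of _ ?g] conjI)
qed

text \<open>
  Every map from a set \<open>S\<close> of at most \<open>m\<close> points of \<open>A\<close> into \<open>A\<close> agrees on \<open>S\<close> with a product of
  idempotents of rank \<open>m\<close>. The induction is on the number of points plus the number of points that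
  are not yet at their target.
\<close>

lemma generated_maps_realise:
  assumes "S \<subseteq> A" "card S \<le> m" "q ` S \<subseteq> A" and m: "1 \<le> m" "m < card A"
  shows "\<exists>g\<in>gen (star a) (E m). \<forall>x\<in>S. g x = q x"
  using assms(1-3)
proof (induction "card S + card {x \<in> S. q x \<noteq> x}" arbitrary: S q rule: less_induct)
  case less
  note SA = less.prems(1) and Sm = less.prems(2) and qS = less.prems(3)
  have aS: "a x = x" if "x \<in> S" for x using SA that by (rule a_fix_on)
  \<comment> \<open>Two points with the same target are merged first. For an injective \<open>q\<close> a point \<open>i\<close> is moved to its
    target \<open>q i\<close>; if a point of \<open>S\<close> occupies that place, it is first moved out of the way.\<close>
  consider (merge) c d where "c \<in> S" "d \<in> S" "c \<noteq> d" "q c = q d"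
    | (slide) i where "inj_on q S" "i \<in> S" "q i \<noteq> i" "q i \<notin> S"
    | (swap) i where "inj_on q S" "i \<in> S" "q i \<noteq> i" "q i \<in> S"
    | (still) "\<forall>x\<in>S. q x = x"
    unfolding inj_on_def by metis
  then show ?case
  proof cases
    case merge
    obtain g where g: "g \<in> E m" "g c = d" "\<forall>x\<in>S - {c}. g x = x"
      using moving_idempotent[OF SA Sm m(2), of c d] merge SA by blast
    have "card (S - {c}) + card {x \<in> S - {c}. q x \<noteq> x} < card S + card {x \<in> S. q x \<noteq> x}"
      using merge(1) by (intro add_less_le_mono card_Diff1_less card_mono) auto
    moreover have "S - {c} \<subseteq> A" "card (S - {c}) \<le> m" "q ` (S - {c}) \<subseteq> A"
      using SA Sm qS card_Diff1_le[of S c] by auto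
    ultimately obtain h where h: "h \<in> gen (star a) (E m)" "\<forall>x\<in>S - {c}. h x = q x"
      using less.hyps by blast
    have "(g \<star> h) x = q x" if "x \<in> S" for x
      using that g h merge aS by (cases "x = c") auto
    then show ?thesis by (intro bexI[OF _ gen.mult[OF gen.base[OF g(1)] h(1)]]) auto
  next
    case slide
    obtain g where g: "g \<in> E m" "g i = q i" "\<forall>x\<in>S - {i}. g x = x"
      using moving_idempotent[OF SA Sm m(2) slide(2), of "q i"] slide qS by blast
    let ?S = "insert (q i) (S - {i})" and ?q = "q(q i := q i)"
    have c: "card ?S = card S" using slide by (intro card_exchange) auto
    have "{x \<in> ?S. ?q x \<noteq> x} \<subset> {x \<in> S. q x \<noteq> x}"
    proof (rule psubsetI)
      show "{x \<in> ?S. ?q x \<noteq> x} \<subseteq> {x \<in> S. q x \<noteq> x}" by auto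
      have "i \<in> {x \<in> S. q x \<noteq> x}" "i \<notin> {x \<in> ?S. ?q x \<noteq> x}" using slide by auto
      then show "{x \<in> ?S. ?q x \<noteq> x} \<noteq> {x \<in> S. q x \<noteq> x}" by blast
    qed
    then have "card {x \<in> ?S. ?q x \<noteq> x} < card {x \<in> S. q x \<noteq> x}" by (intro psubset_card_mono) auto
    then have "card ?S + card {x \<in> ?S. ?q x \<noteq> x} < card S + card {x \<in> S. q x \<noteq> x}" using c by simp
    moreover have "?S \<subseteq> A" "card ?S \<le> m" "?q ` ?S \<subseteq> A"
      using SA Sm qS slide(2) c by auto
    ultimately obtain h where h: "h \<in> gen (star a) (E m)" "\<forall>x\<in>?S. h x = ?q x"
      using less.hyps by blast
    have "a (q i) = q i" using qS slide(2) by (intro a_fix) auto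
    then have "(g \<star> h) x = q x" if "x \<in> S" for x
      using that g h slide aS by (cases "x = i") auto
    then show ?thesis by (intro bexI[OF _ gen.mult[OF gen.base[OF g(1)] h(1)]]) auto
  next
    case swap
    define j where "j = q i"
    have j: "j \<in> S" "j \<noteq> i" "q j \<noteq> j"
      using swap unfolding j_def by (auto dest: inj_onD)
    have "\<not> A \<subseteq> S" using Sm m(2) card_mono[of S A] by auto
    then obtain c where c: "c \<in> A" "c \<notin> S" by blast
    have ac: "a c = c" using c by (intro a_fix)
    obtain g where g: "g \<in> E m" "g j = c" "\<forall>x\<in>S - {j}. g x = x"
      using moving_idempotent[OF SA Sm m(2) j(1) c(1)] c j by blast
    let ?T = "insert c (S - {j})"
    have "card ?T = card S" using j(1) c(2) by (intro card_exchange) simp_all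
    moreover have "?T \<subseteq> A" using SA c(1) by blast
    ultimately have T: "?T \<subseteq> A" "card ?T = card S" by simp_all
    obtain h where h: "h \<in> E m" "h i = j" "\<forall>x\<in>?T - {i}. h x = x"
      using moving_idempotent[of ?T m i j] T Sm m(2) swap j SA by auto
    let ?S = "insert j (?T - {i})" and ?q = "q(c := q j, j := j)"
    have "j \<notin> ?T" using c j by auto
    then have cS: "card ?S = card S" using T(2) swap j(2) by (subst card_exchange) simp_all
    let ?w = "{x \<in> S. q x \<noteq> x}"
    have "{x \<in> ?S. ?q x \<noteq> x} \<subseteq> insert c (?w - {i} - {j})" by auto
    then have "card {x \<in> ?S. ?q x \<noteq> x} \<le> card (insert c (?w - {i} - {j}))"
      by (intro card_mono) auto
    also have "\<dots> \<le> Suc (card (?w - {i} - {j}))" by (simp add: card_insert_if)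
    also have "\<dots> \<le> card (?w - {i})"
      using card_Diff1_less[of "?w - {i}" j] j by auto
    also have "\<dots> < card ?w"
      using swap by (intro card_Diff1_less) auto
    finally have "card ?S + card {x \<in> ?S. ?q x \<noteq> x} < card S + card ?w" using cS by simp
    moreover have "?S \<subseteq> A" using T(1) SA j(1) by blast
    moreover have "card ?S \<le> m" using cS Sm by simp
    moreover have "?q ` ?S \<subseteq> A"
    proof (rule image_subsetI)
      fix x assume "x \<in> ?S"
      then consider "x = j" | "x = c" "x \<noteq> j" | "x \<in> S" "x \<noteq> j" "x \<noteq> c" by blast
      then show "?q x \<in> A" using j(1) SA qS by cases auto
    qed
    ultimately have "\<exists>k\<in>gen (star a) (E m). \<forall>x\<in>?S. k x = ?q x"
      by (rule less.hyps)
    then obtain k where k: "k \<in> gen (star a) (E m)" "\<forall>x\<in>?S. k x = ?q x" ..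
    have "(g \<star> h \<star> k) x = q x" if x: "x \<in> S" for x
    proof -
      consider "x = i" | "x = j" | "x \<noteq> i" "x \<noteq> j" by blast
      then show ?thesis
      proof cases
        case 1
        then show ?thesis using g h k swap j aS by (simp add: j_def)
      next
        case 2
        have "c \<noteq> i" "c \<noteq> j" using c swap j by auto
        then show ?thesis using 2 g h k ac by simp
      next
        case 3
        moreover have "x \<noteq> c" using c x by blast
        ultimately show ?thesis using g h k x aS by simp
      qed
    qed
    then show ?thesis
      by (intro bexI[OF _ gen.mult[OF gen.mult[OF gen.base[OF g(1)] gen.base[OF h(1)]] k(1)]]) auto
  next
    case still
    obtain V where V: "S \<subseteq> V" "V \<subseteq> A" "card V = m"
      using exists_subset_between[OF Sm _ SA] m by auto
    then obtain v where "v \<in> V" using m by fastforce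
    let ?g = "\<lambda>x. if x \<in> V then x else v"
    have "?g \<in> E m" using V \<open>v \<in> V\<close> by (intro retraction_idempotent[of V]) auto
    then show ?thesis using V still by (intro bexI[of _ ?g] gen.base) auto
  qed
qed

text \<open>
  The factorization is \<open>f = e \<star> g \<star> h\<close>, where \<open>e\<close> retracts onto a subset \<open>W\<close> of \<open>A\<close> containing a
  transversal of \<open>f\<close> without leaving the fibres of \<open>f\<close>, the product \<open>g\<close> of idempotents agrees with
  \<open>a \<circ> f\<close> on \<open>W\<close>, and \<open>h\<close> sends each point of \<open>a ` range f\<close> back to the image of \<open>f\<close>.
\<close>

lemma I_low_subset_gen:
  assumes m: "1 \<le> m" "m < card A"
  shows "I_low a m \<subseteq> gen (star a) (E m)"
proof
  fix f assume "f \<in> I_low a m"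
  then have f: "f \<in> P" "map_rank f \<le> m" by (auto simp: I_low_eq)
  then have inj: "inj_on a (range f)" by (simp add: P_iff)
  obtain B where B: "B \<subseteq> A" "inj_on f B" "f ` B = range f" "card B = map_rank f"
    using transversal[OF f(1)] .
  obtain W where W: "B \<subseteq> W" "W \<subseteq> A" "card W = m"
    using exists_subset_between[of B m A] B f m by auto
  define e where "e x = (if x \<in> W then x else inv_into B f (f x))" for x
  have fB: "f x \<in> f ` B" for x using B(3) by simp
  have inv: "inv_into B f (f x) \<in> B" "f (inv_into B f (f x)) = f x" for x
    using inv_into_into[OF fB] f_inv_into_f[OF fB] by simp_all
  have eW: "e x \<in> W" for x
    using subsetD[OF W(1) inv(1)] by (simp add: e_def)
  have fe: "f (e x) = f x" for x
    using inv(2) by (simp add: e_def)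
  have e: "e \<in> E m" using eW by (intro retraction_idempotent[OF W(2,3)]) (simp_all add: e_def)
  have "(\<lambda>x. a (f x)) ` W \<subseteq> A" by auto
  then obtain g where g: "g \<in> gen (star a) (E m)" "\<And>x. x \<in> W \<Longrightarrow> g x = a (f x)"
    using generated_maps_realise[OF W(2) _ _ m, of "\<lambda>x. a (f x)"] W(3) by auto
  have "card (a ` range f) \<le> m" using f(2) card_image[OF inj] by (simp add: map_rank_def)
  moreover have "m \<le> card A" using m(2) by simp
  moreover have "a ` range f \<subseteq> A" by blast
  ultimately have "\<exists>V. a ` range f \<subseteq> V \<and> V \<subseteq> A \<and> card V = m"
    by (rule exists_subset_between) simp
  then obtain V where V: "a ` range f \<subseteq> V" "V \<subseteq> A" "card V = m" by (elim exE conjE)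
  have fV: "a (f x) \<in> V" for x using V(1) by (rule subsetD) (rule imageI, rule rangeI)
  define \<tau> where "\<tau> v = (if v \<in> a ` range f then inv_into (range f) a v else v)" for v
  define \<pi> where "\<pi> x = (if a x \<in> V then a x else a (f x))" for x
  have "a (\<tau> v) = v" if "v \<in> V" for v
  proof (cases "v \<in> a ` range f")
    case True then show ?thesis using f_inv_into_f[OF True] by (simp only: \<tau>_def if_True)
  next
    case False then show ?thesis using a_fix_on[OF V(2) that] by (simp only: \<tau>_def if_False)
  qed
  moreover have "\<pi> x \<in> V" for x using fV by (simp add: \<pi>_def)
  moreover have "\<pi> v = v" if "v \<in> V" for v using a_fix_on[OF V(2) that] that by (simp add: \<pi>_def)
  ultimately have h: "(\<lambda>x. \<tau> (\<pi> x)) \<in> E m" (is "?h \<in> _")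
    by (intro section_idempotent(1)[OF V(2,3)])
  have "f = e \<star> g \<star> ?h"
  proof
    fix x
    have "a (e x) = e x" using W(2) eW by (rule a_fix_on)
    then have "(e \<star> g) x = a (f x)" using eW g(2) fe by simp
    moreover have "\<pi> (a (f x)) = a (f x)" using fV by (simp add: \<pi>_def)
    moreover have "\<tau> (a (f x)) = f x" using inj by (simp add: \<tau>_def)
    ultimately show "f x = (e \<star> g \<star> ?h) x" by simp
  qed
  then show "f \<in> gen (star a) (E m)"
    using e g(1) h by (metis gen.base gen.mult)
qed

lemma gen_subset_I_low: "U \<subseteq> I_low a m \<Longrightarrow> gen (star a) U \<subseteq> I_low a m"
  by (rule gen_subset_closed) (auto intro: I_low_star subsetD[OF I_low_subset_P])

lemma E_subset_I_low: "1 \<le> m \<Longrightarrow> E m \<subseteq> I_low a m"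
  by (auto simp: idempotents_def I_low_def)

lemma I_low_eq_gen:
  assumes "1 \<le> m" "m < card A"
  shows "I_low a m = gen (star a) (E m)"
  using I_low_subset_gen[OF assms] gen_subset_I_low[OF E_subset_I_low[OF assms(1)]] by simp

section \<open>Kernels of regular maps\<close>

lemma fibres_meeting:
  assumes f: "f \<in> P" "map_rank f = m"
  shows "fibres f \<in> meeting_partitions UNIV A m"
proof -
  have "partition_on UNIV (fibres f)"
    by (rule partition_onI) (auto simp: fibres_def disjnt_def)
  moreover have "p \<inter> A \<noteq> {}" if p: "p \<in> fibres f" for p
  proof -
    obtain x where x: "p = f -` {f x}" using p by (auto simp: fibres_def)
    have "f x \<in> f ` A" using f(1) by (simp add: P_iff)
    then obtain z where "z \<in> A" "f x = f z" by (rule imageE)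
    then show ?thesis unfolding x by auto
  qed
  ultimately show ?thesis
    using f(2) by (simp add: meeting_partitions_def card_fibres)
qed

lemma idempotent_with_fibres:
  assumes Q: "Q \<in> meeting_partitions UNIV A m"
  shows "\<exists>e\<in>E m. fibres e = Q"
proof -
  have UQ: "\<Union>Q = UNIV" and dQ: "disjoint Q" and cQ: "card Q = m" and mQ: "\<And>p. p \<in> Q \<Longrightarrow> p \<inter> A \<noteq> {}"
    using Q by (simp_all add: meeting_partitions_def partition_on_def)
  have "\<exists>p. p \<in> Q \<and> x \<in> p" for x using UQ by blast
  then obtain b where b: "\<And>x. b x \<in> Q" "\<And>x. x \<in> b x" by metis
  have bu: "b x = p" if "p \<in> Q" "x \<in> p" for x p
    using disjointD[OF dQ b(1)[of x] that(1)] b(2)[of x] that(2) by auto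
  have "\<exists>t. t \<in> p \<and> t \<in> A" if "p \<in> Q" for p using mQ[OF that] by blast
  then obtain t where t: "\<And>p. p \<in> Q \<Longrightarrow> t p \<in> p" "\<And>p. p \<in> Q \<Longrightarrow> t p \<in> A" by metis
  have bt: "b (t p) = p" if "p \<in> Q" for p using bu[OF that t(1)[OF that]] .
  define e where "e x = t (b x)" for x
  have "inj_on t Q" using bt by (metis inj_onI)
  then have "card (t ` Q) = m" using cQ by (simp add: card_image)
  moreover have "t ` Q \<subseteq> A" using t(2) by (rule image_subsetI)
  moreover have "e x \<in> t ` Q" for x unfolding e_def using b(1) by (rule imageI)
  moreover have "e v = v" if v: "v \<in> t ` Q" for v
  proof -
    obtain p where "p \<in> Q" "v = t p" using v by (rule imageE)
    then show ?thesis by (simp add: e_def bt)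
  qed
  ultimately have "e \<in> E m" by (intro retraction_idempotent[of "t ` Q"])
  moreover have "fibres e = Q"
  proof -
    have "e -` {e x} = b x" for x
    proof (rule set_eqI)
      fix y
      have "y \<in> e -` {e x} \<longleftrightarrow> t (b y) = t (b x)" by (simp add: e_def)
      also have "\<dots> \<longleftrightarrow> b y = b x" using bt[OF b(1)] by metis
      also have "\<dots> \<longleftrightarrow> y \<in> b x" using b(2)[of y] bu[OF b(1)[of x]] by metis
      finally show "y \<in> e -` {e x} \<longleftrightarrow> y \<in> b x" .
    qed
    then have "fibres e = range b" by (simp add: fibres_def)
    also have "range b = Q"
    proof (rule subset_antisym)
      show "range b \<subseteq> Q" using b(1) by (rule image_subsetI)
      show "Q \<subseteq> range b" using bt by (metis rangeI subsetI)
    qed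
    finally show ?thesis .
  qed
  ultimately show ?thesis by (intro bexI)
qed

text \<open>
  The kernel of a product contains the kernel of its first factor, and for equal ranks the two
  coincide. So the kernel of every map of rank \<open>m\<close> is the kernel of a generator.
\<close>

lemma card_generating_set_ge:
  assumes gen: "gen (star a) U = I_low a m" and m: "1 \<le> m"
  shows "card (meeting_partitions UNIV A m) \<le> card U"
proof -
  have coarser: "\<exists>u\<in>U. \<forall>x y. u x = u y \<longrightarrow> f x = f y" if "f \<in> gen (star a) U" for f
    using that
  proof induction
    case (base x)
    then show ?case by blast
  next
    case (mult x y)
    then obtain u where u: "u \<in> U" "\<forall>v w. u v = u w \<longrightarrow> x v = x w" by blast
    then have "\<forall>v w. u v = u w \<longrightarrow> (x \<star> y) v = (x \<star> y) w" by (metis star_apply)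
    then show ?case by (intro bexI[OF _ u(1)])
  qed
  have "meeting_partitions UNIV A m \<subseteq> fibres ` U"
  proof
    fix Q assume "Q \<in> meeting_partitions UNIV A m"
    then obtain e where e: "e \<in> E m" "fibres e = Q" using idempotent_with_fibres by metis
    then have "e \<in> gen (star a) U" using gen E_subset_I_low[OF m] by auto
    then obtain u where u: "u \<in> U" "\<And>x y. u x = u y \<Longrightarrow> e x = e y" using coarser by metis
    have "u \<in> I_low a m" using gen.base[OF u(1)] gen by metis
    then have "map_rank u \<le> map_rank e" using e(1) by (simp add: I_low_eq E_iff)
    then have "fibres u = fibres e" using u(2) by (intro fibres_eqI)
    then show "Q \<in> fibres ` U" using e(2) u(1) by (metis imageI)
  qed
  then have "card (meeting_partitions UNIV A m) \<le> card (fibres ` U)" by (intro card_mono) auto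
  also have "\<dots> \<le> card U" by (intro card_image_le) auto
  finally show ?thesis .
qed

section \<open>Idempotents from arcs of a cycle\<close>

text \<open>
  For a non-empty partial transversal \<open>Y\<close> of the kernel of \<open>a\<close>, this map has image \<open>Y\<close>.
  On \<open>A\<close> its kernel is the partition into the arcs of \<open>a ` Y\<close>. A point \<open>x\<close> outside \<open>A\<close> joins the arc of \<open>a x\<close> if it is not in \<open>Y\<close>,
  and the next arc if it is in \<open>Y\<close>; this deviation makes \<open>Y\<close> recoverable from the kernel.
\<close>

definition arc_idempotent :: "('x \<Rightarrow> 'x) \<Rightarrow> 'x set \<Rightarrow> 'x \<Rightarrow> 'x" where
  "arc_idempotent c Y x =
     inv_into Y a (first_hit c (a ` Y) (if x \<in> Y - A then c (a x) else a x))"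

lemma arc_idempotent_E:
  assumes c: "full_cycle c A" and Y: "card Y = m" "1 \<le> m" "inj_on a Y"
  shows "arc_idempotent c Y \<in> E m" "range (arc_idempotent c Y) = Y"
    "\<And>y. y \<in> Y \<Longrightarrow> arc_idempotent c Y (a y) = y"
proof -
  let ?V = "a ` Y" and ?\<tau> = "inv_into Y a"
  let ?\<pi> = "\<lambda>x. first_hit c (a ` Y) (if x \<in> Y - A then c (a x) else a x)"
  have V: "?V \<subseteq> A" by auto
  have cV: "card ?V = m" using Y by (simp add: card_image)
  have ne: "?V \<noteq> {}" using Y by auto
  have sec: "a (?\<tau> v) = v" if "v \<in> ?V" for v using that by (rule f_inv_into_f)
  have "(if x \<in> Y - A then c (a x) else a x) \<in> A" for x
    using full_cycle_closed[OF c rangeI, of x] by simp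
  then have ret: "?\<pi> x \<in> ?V" for x using c V ne by (intro first_hit_mem)
  have fixed: "?\<pi> v = v" if "v \<in> ?V" for v
  proof -
    have "v \<in> A" using V that by (rule subsetD)
    moreover from this have "a v = v" by (rule a_fix)
    ultimately show ?thesis using that by simp
  qed
  have eq: "arc_idempotent c Y = (\<lambda>x. ?\<tau> (?\<pi> x))"
    by (rule ext) (simp only: arc_idempotent_def)
  show "arc_idempotent c Y \<in> E m"
    unfolding eq using V cV sec ret fixed by (rule section_idempotent(1))
  have "range (arc_idempotent c Y) = ?\<tau> ` ?V"
    unfolding eq using V cV sec ret fixed by (rule section_idempotent(2))
  also have "\<dots> = Y" using Y(3) by (simp add: inv_into_image_cancel)
  finally show "range (arc_idempotent c Y) = Y" .
  fix y assume "y \<in> Y"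
  then show "arc_idempotent c Y (a y) = y"
    unfolding eq using fixed[of "a y"] Y(3) by simp
qed

lemma arc_idempotent_on_A:
  assumes "x \<in> A"
  shows "arc_idempotent c Y x = inv_into Y a (first_hit c (a ` Y) x)"
  using assms a_fix[OF assms] by (simp add: arc_idempotent_def)

text \<open>
  The right-hand side depends only on the kernel of the map. Points of \<open>a ` Y\<close> are recognized as ends
  of arcs, points of \<open>Y\<close> outside \<open>A\<close> by not lying in the same block as their image under \<open>a\<close>. A point of
  \<open>A\<close> is in \<open>Y\<close> iff it is in \<open>a ` Y\<close> and is not the image of a point of \<open>Y\<close> outside \<open>A\<close>.
\<close>

lemma image_determined_by_fibres:
  assumes c: "full_cycle c A" and Y: "1 < card Y" "inj_on a Y"
  shows "Y = {x. if x \<in> A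
      then arc_idempotent c Y (c x) \<noteq> arc_idempotent c Y x \<and>
        (\<forall>z. z \<notin> A \<and> a z = x \<longrightarrow> arc_idempotent c Y z = arc_idempotent c Y x)
      else arc_idempotent c Y (c (a x)) \<noteq> arc_idempotent c Y (a x) \<and>
        arc_idempotent c Y x \<noteq> arc_idempotent c Y (a x)}"
proof -
  let ?V = "a ` Y" and ?\<tau> = "inv_into Y a" and ?h = "arc_idempotent c Y"
  have V: "?V \<subseteq> A" by auto
  have cV: "1 < card ?V" using Y by (simp add: card_image)
  then have ne: "?V \<noteq> {}" by auto
  have inj: "?\<tau> u = ?\<tau> v \<longleftrightarrow> u = v" if "u \<in> ?V" "v \<in> ?V" for u v
    using that f_inv_into_f[of _ a Y] by metis
  have cA: "c x \<in> A" if "x \<in> A" for x using full_cycle_closed[OF c that] .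
  have hit: "first_hit c ?V x \<in> ?V" if "x \<in> A" for x
    using c that V ne by (rule first_hit_mem)
  have mem: "?h (c x) \<noteq> ?h x \<longleftrightarrow> x \<in> ?V" if x: "x \<in> A" for x
    using first_hit_eq_next_iff[OF c x V cV] inj[OF hit[OF cA[OF x]] hit[OF x]]
    by (simp add: arc_idempotent_on_A x cA)
  have out: "?h x = ?h (a x) \<longleftrightarrow> x \<notin> Y" if x: "x \<notin> A" "a x \<in> ?V" for x
  proof (cases "x \<in> Y")
    case True
    have "?h x = ?h (c (a x))" using True x(1) arc_idempotent_on_A[OF cA[OF rangeI[of a x]]]
      by (simp add: arc_idempotent_def)
    then show ?thesis using True mem[of "a x"] x(2) by simp
  next
    case False
    have "?h x = ?h (a x)" using False arc_idempotent_on_A[OF rangeI[of a x]]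
      by (simp add: arc_idempotent_def)
    then show ?thesis using False by simp
  qed
  show ?thesis
  proof (rule set_eqI, unfold mem_Collect_eq)
    fix x
    show "x \<in> Y \<longleftrightarrow> (if x \<in> A then ?h (c x) \<noteq> ?h x \<and> (\<forall>z. z \<notin> A \<and> a z = x \<longrightarrow> ?h z = ?h x)
      else ?h (c (a x)) \<noteq> ?h (a x) \<and> ?h x \<noteq> ?h (a x))"
    proof (cases "x \<in> A")
      case True
      have ax: "a x = x" using True by (rule a_fix)
      have "x \<in> Y \<longleftrightarrow> x \<in> ?V \<and> (\<forall>z. z \<notin> A \<and> a z = x \<longrightarrow> z \<notin> Y)"
      proof
        assume xY: "x \<in> Y"
        then have "x \<in> ?V" using imageI[OF xY, of a] ax by simp
        moreover have "z \<notin> Y" if "z \<notin> A \<and> a z = x" for z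
          using that xY ax True inj_onD[OF Y(2), of z x] by auto
        ultimately show "x \<in> ?V \<and> (\<forall>z. z \<notin> A \<and> a z = x \<longrightarrow> z \<notin> Y)" by simp
      next
        assume R: "x \<in> ?V \<and> (\<forall>z. z \<notin> A \<and> a z = x \<longrightarrow> z \<notin> Y)"
        then obtain y where y: "y \<in> Y" "x = a y" by (metis imageE)
        then have "y \<in> A" using R by metis
        then show "x \<in> Y" using y a_fix by metis
      qed
      also have "\<dots> \<longleftrightarrow> x \<in> ?V \<and> (\<forall>z. z \<notin> A \<and> a z = x \<longrightarrow> ?h z = ?h x)"
        using out by metis
      finally show ?thesis using True mem[OF True] by simp
    next
      case False
      have "x \<in> Y \<longleftrightarrow> a x \<in> ?V \<and> ?h x \<noteq> ?h (a x)"
        using out[OF False] by blast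
      then show ?thesis using False mem[OF rangeI[of a x]] by simp
    qed
  qed
qed

lemma arc_idempotent_fibres_inject:
  assumes c: "full_cycle c A" and Y: "1 < card Y" "inj_on a Y" and Z: "1 < card Z" "inj_on a Z"
    and eq: "fibres (arc_idempotent c Y) = fibres (arc_idempotent c Z)"
  shows "Y = Z"
proof -
  have "arc_idempotent c Y x = arc_idempotent c Y y \<longleftrightarrow> arc_idempotent c Z x = arc_idempotent c Z y" for x y
    using eq by (simp only: fibres_eq_iff)
  then show ?thesis
    by (subst image_determined_by_fibres[OF c Y], subst image_determined_by_fibres[OF c Z]) (simp only:)
qed

lemma fibres_star:
  assumes "inj_on a (range f)" "inj_on g (a ` range f)"
  shows "fibres (f \<star> g) = fibres f"
proof -
  have "g (a (f x)) = g (a (f y)) \<longleftrightarrow> f x = f y" for x y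
    using inj_onD[OF assms(1), of "f x" "f y"] inj_onD[OF assms(2), of "a (f x)" "a (f y)"] by auto
  then show ?thesis unfolding fibres_eq_iff by simp
qed

text \<open>
  The map \<open>g\<close> lies in the maximal subgroup with identity \<open>d\<close>: it induces the permutation \<open>\<sigma>\<close> of the common
  image by \<open>y \<mapsto> g (a y)\<close>. If \<open>\<sigma> ^^ Suc k\<close> is the identity, then \<open>d\<close> is the \<open>Suc k\<close>-th power of \<open>g\<close>.
\<close>

lemma idempotent_power:
  assumes d: "d \<in> E m" and g: "g \<in> gen (star a) U"
    and fib: "fibres g = fibres d" and ran: "range g = range d"
  shows "d \<in> gen (star a) U"
proof -
  let ?Y = "range d"
  define \<sigma> where "\<sigma> y = (if y \<in> ?Y then g (a y) else y)" for y
  have dd: "d (a (d z)) = d z" for z using d by (metis E_iff star_apply)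
  have gd: "g (a (d z)) = g z" for z
    using fib dd[of z] unfolding fibres_eq_iff by metis
  have sY: "\<sigma> ` ?Y = ?Y"
  proof -
    have "\<sigma> (d z) = g z" for z by (simp add: \<sigma>_def gd)
    then have "\<sigma> ` ?Y = range g" by (simp add: image_image)
    then show ?thesis using ran by simp
  qed
  have "inj \<sigma>"
  proof (rule injI)
    fix x y assume xy: "\<sigma> x = \<sigma> y"
    have "inj_on \<sigma> ?Y" using sY by (intro eq_card_imp_inj_on) simp_all
    moreover have "\<sigma> z \<in> ?Y \<longleftrightarrow> z \<in> ?Y" for z
    proof (cases "z \<in> ?Y")
      case True
      then show ?thesis using sY by (metis imageI)
    next
      case False
      then show ?thesis by (simp add: \<sigma>_def)
    qed
    moreover have "\<sigma> z = z" if "z \<notin> ?Y" for z using that by (simp add: \<sigma>_def)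
    ultimately show "x = y" using xy by (metis inj_onD)
  qed
  then have "permutation \<sigma>" unfolding permutation by (simp add: finite_UNIV_inj_surj bij_def)
  then obtain n where n: "\<sigma> ^^ n = id" "0 < n" by (rule permutation_is_nilpotent)
  then obtain k where k: "n = Suc k" using gr0_implies_Suc by blast
  have pow: "(\<lambda>x. (\<sigma> ^^ j) (g x)) \<in> gen (star a) U" for j
  proof (induction j)
    case 0
    then show ?case using g by (simp only: funpow_0)
  next
    case (Suc j)
    have "(\<sigma> ^^ j) y \<in> ?Y" if "y \<in> ?Y" for j y
    proof (induction j)
      case (Suc j)
      then show ?case using sY by (metis funpow.simps(2) comp_apply imageI)
    qed (simp add: that)
    then have "(\<sigma> ^^ j) (g x) \<in> ?Y" for x using ran by (metis rangeI)
    then have "(\<lambda>x. (\<sigma> ^^ Suc j) (g x)) = (\<lambda>x. (\<sigma> ^^ j) (g x)) \<star> g"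
      by (simp add: fun_eq_iff \<sigma>_def)
    then show ?case using gen.mult[OF Suc.IH g] by (simp only:)
  qed
  have "d x = (\<sigma> ^^ k) (g x)" for x
  proof -
    have "\<sigma> (d x) = g x" by (simp add: \<sigma>_def gd)
    then have "(\<sigma> ^^ n) (d x) = (\<sigma> ^^ k) (g x)" by (simp add: k funpow_swap1)
    then show ?thesis using n(1) by simp
  qed
  then have "d = (\<lambda>x. (\<sigma> ^^ k) (g x))" by (rule ext)
  then show ?thesis using pow by simp
qed

section \<open>Rank and idempotent rank\<close>

text \<open>
  The idempotents \<open>e Q\<close>, one for each kernel \<open>Q\<close>, extend the family of all \<open>arc_idempotent c Y\<close>, which
  is possible because different images \<open>Y\<close> belong to different kernels.
\<close>

lemma small_idempotent_generating_set:
  assumes m: "1 < m"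
  shows "\<exists>U\<subseteq>E m. card U \<le> card (meeting_partitions UNIV A m) \<and> E m \<subseteq> gen (star a) U"
proof -
  let ?M = "meeting_partitions UNIV A m"
  obtain c where c: "full_cycle c A" using full_cycle_exists[of A] by auto
  let ?h = "arc_idempotent c"
  define images where "images = {Y. card Y = m \<and> inj_on a Y}"
  have imD: "card Y = m" "1 \<le> m" "inj_on a Y" "1 < card Y" if "Y \<in> images" for Y
    using that m by (simp_all add: images_def)
  have h: "?h Y \<in> E m" "range (?h Y) = Y" "\<And>y. y \<in> Y \<Longrightarrow> ?h Y (a y) = y" if "Y \<in> images" for Y
    using arc_idempotent_E[OF c imD(1-3)[OF that]] by blast+
  have "\<exists>e\<in>E m. fibres e = Q \<and> (\<forall>Y\<in>images. fibres (?h Y) = Q \<longrightarrow> e = ?h Y)" if Q: "Q \<in> ?M" for Q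
  proof (cases "\<exists>Y\<in>images. fibres (?h Y) = Q")
    case True
    then obtain Y where Y: "Y \<in> images" "fibres (?h Y) = Q" by blast
    have unique: "?h Y = ?h Z" if "Z \<in> images" "fibres (?h Z) = Q" for Z
      using arc_idempotent_fibres_inject[OF c imD(4,3)[OF Y(1)] imD(4,3)[OF that(1)]] Y(2) that(2) by simp
    show ?thesis
      by (intro bexI[OF _ h(1)[OF Y(1)]] conjI ballI impI) (rule Y(2), rule unique)
  next
    case False
    obtain e where e: "e \<in> E m" "fibres e = Q" using idempotent_with_fibres[OF Q] by blast
    show ?thesis
      by (intro bexI[OF _ e(1)] conjI ballI impI) (rule e(2), use False in blast)
  qed
  then obtain e where e: "\<And>Q. Q \<in> ?M \<Longrightarrow> e Q \<in> E m" "\<And>Q. Q \<in> ?M \<Longrightarrow> fibres (e Q) = Q"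
    "\<And>Q Y. Q \<in> ?M \<Longrightarrow> Y \<in> images \<Longrightarrow> fibres (?h Y) = Q \<Longrightarrow> e Q = ?h Y"
    by metis
  define U where "U = e ` ?M"
  have UE: "U \<subseteq> E m" unfolding U_def using e(1) by (rule image_subsetI)
  have cU: "card U \<le> card ?M" unfolding U_def by (intro card_image_le) simp
  have E_M: "fibres d \<in> ?M" if "d \<in> E m" for d
    using fibres_meeting[OF subsetD[OF E_subset_P that]] that by (simp add: E_iff)
  have E_im: "range d \<in> images" if "d \<in> E m" for d
    using subsetD[OF E_subset_P that] that by (simp add: images_def E_iff P_iff map_rank_def)
  have hU: "?h Y \<in> U" if "Y \<in> images" for Y
    using e(3)[OF E_M[OF h(1)[OF that]] that refl] E_M[OF h(1)[OF that]] unfolding U_def by (metis imageI)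
  have genP: "gen (star a) U \<subseteq> P"
    using UE E_subset_P star_in_P by (intro gen_subset_closed) auto
  \<comment> \<open>Starting from \<open>e Q\<close>, follow a sequence of moves from \<open>a ` range (e Q)\<close> to \<open>a ` Y\<close>. The images on the
    way are taken inside \<open>A\<close>; only a last factor leads from \<open>a ` Y\<close> to \<open>Y\<close>.\<close>
  have reach: "\<exists>g\<in>gen (star a) U. fibres g = Q \<and> range g = Y" if Q: "Q \<in> ?M" and Y: "Y \<in> images" for Q Y
  proof -
    let ?B = "a ` range (e Q)"
    have sub: "a ` Z \<subseteq> A" for Z by blast
    have card_a: "card (a ` Z) = m" if "Z \<in> images" for Z
      using imD(1,3)[OF that] by (simp add: card_image)
    have r: "range (e Q) \<in> images" using E_im e(1)[OF Q] by blast
    have "(shift_step c)\<^sup>*\<^sup>* ?B (a ` Y)"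
      using c sub card_a[OF r] sub card_a[OF Y] by (rule shift_steps_strongly_connected)
    then have "a ` Y \<subseteq> A \<and> card (a ` Y) = m \<and>
      (\<exists>g\<in>gen (star a) U. fibres g = Q \<and> a ` range g = a ` Y)"
    proof (induction rule: rtranclp_induct)
      case base
      have "e Q \<in> gen (star a) U" unfolding U_def using Q by (intro gen.base imageI)
      then show ?case using e(2)[OF Q] card_a[OF r] sub by blast
    next
      case (step B C)
      then obtain g where B: "B \<subseteq> A" "card B = m" and g: "g \<in> gen (star a) U" "fibres g = Q" "a ` range g = B"
        by blast
      obtain x where x: "x \<in> B" "c x \<notin> B" "C = insert (c x) (B - {x})"
        using step.hyps(2) by (auto simp: shift_step_def)
      have "c x \<in> A" using full_cycle_closed[OF c] x(1) B(1) by blast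
      then have CA: "C \<subseteq> A" using x(3) B(1) by blast
      have cC: "card C = m" using x B(2) card_exchange[of B x "c x"] by simp
      have C: "C \<in> images" using cC a_inj_on[OF CA] by (simp add: images_def)
      have aC: "a ` C = C" using a_image_id[OF CA] .
      have hC: "?h C y = first_hit c C y" if "y \<in> A" for y
      proof -
        have "first_hit c C y \<in> C"
          using cC m by (intro first_hit_mem[OF c that CA]) auto
        then show ?thesis
          using arc_idempotent_on_A[OF that, of c C] inv_into_f_f[OF a_inj_on[OF CA], of "first_hit c C y"]
            a_fix_on[OF CA] by (simp add: aC)
      qed
      have inj: "inj_on (?h C) B"
        using first_hit_inj_on_shift[OF step.hyps(2)] hC B(1) inj_on_cong[of B "?h C" "first_hit c C"]
        by blast
      have "inj_on a (range g)" using subsetD[OF genP g(1)] by (simp add: P_iff)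
      then have fib: "fibres (g \<star> ?h C) = Q" using fibres_star[of g "?h C"] inj g by simp
      have "?h C ` B \<subseteq> C" using h(2)[OF C] by blast
      moreover have "card (?h C ` B) = card C" using inj B(2) cC by (simp add: card_image)
      ultimately have "?h C ` B = C" by (intro card_subset_eq) simp_all
      then have "range (g \<star> ?h C) = C" using g(3) by (simp only: range_star)
      moreover have "g \<star> ?h C \<in> gen (star a) U"
        by (rule gen.mult[OF g(1) gen.base[OF hU[OF C]]])
      ultimately show ?case using fib CA cC aC by metis
    qed
    then obtain g where g: "g \<in> gen (star a) U" "fibres g = Q" "a ` range g = a ` Y" by blast
    have "?h Y ` a ` Y = (\<lambda>y. y) ` Y" unfolding image_image using h(3)[OF Y] by (intro image_cong) simp_all
    then have "range (g \<star> ?h Y) = Y" unfolding range_star g(3) by simp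
    moreover have "inj_on (?h Y) (a ` range g)"
      unfolding g(3) using h(3)[OF Y] by (auto intro!: inj_onI)
    moreover have "inj_on a (range g)" using subsetD[OF genP g(1)] by (simp add: P_iff)
    ultimately have "fibres (g \<star> ?h Y) = Q" "range (g \<star> ?h Y) = Y" using fibres_star[of g "?h Y"] g(2) by simp_all
    moreover have "g \<star> ?h Y \<in> gen (star a) U"
      by (rule gen.mult[OF g(1) gen.base[OF hU[OF Y]]])
    ultimately show ?thesis by metis
  qed
  have "E m \<subseteq> gen (star a) U"
  proof
    fix d assume d: "d \<in> E m"
    obtain g where "g \<in> gen (star a) U" "fibres g = fibres d" "range g = range d"
      using reach[OF E_M[OF d] E_im[OF d]] by metis
    then show "d \<in> gen (star a) U" by (rule idempotent_power[OF d])
  qed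
  then show ?thesis using UE cU by (intro exI[of _ U]) simp
qed

lemma card_meeting_partitions_A:
  "card (meeting_partitions UNIV A m) = m ^ (card (UNIV :: 'x set) - map_rank a) * Stirling (map_rank a) m"
proof -
  have "card (- A) = card (UNIV :: 'x set) - map_rank a"
    unfolding map_rank_def Compl_eq_Diff_UNIV by (intro card_Diff_subset) simp_all
  then show ?thesis
    using card_meeting_partitions[of "- A" A m] by (simp add: map_rank_def Un_commute)
qed

lemma rank_I_low:
  assumes m: "1 < m" "m < map_rank a"
  shows "sg_rank (star a) (I_low a m) = card (meeting_partitions UNIV A m)"
    "sg_idrank (star a) (I_low a m) = card (meeting_partitions UNIV A m)"
proof -
  obtain U where U: "U \<subseteq> E m" "card U \<le> card (meeting_partitions UNIV A m)" "E m \<subseteq> gen (star a) U"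
    using small_idempotent_generating_set[OF m(1)] by blast
  have EI: "E m \<subseteq> I_low a m" using m by (intro E_subset_I_low) simp
  have "I_low a m = gen (star a) (E m)"
    using m by (intro I_low_eq_gen) (simp_all add: map_rank_def)
  also have "\<dots> \<subseteq> gen (star a) U" using U(3) by (rule gen_absorb)
  finally have gen: "gen (star a) U = I_low a m"
    using gen_subset_I_low[of U m] U(1) EI by auto
  have id: "U \<subseteq> idempotents (star a) (I_low a m)"
    using U(1) EI by (auto simp: idempotents_def)
  note args = finite[of U] id gen U(2)
  show "sg_rank (star a) (I_low a m) = card (meeting_partitions UNIV A m)"
    using m by (intro sg_rank_eqI(1)[OF args(1-4)] card_generating_set_ge) simp_all
  show "sg_idrank (star a) (I_low a m) = card (meeting_partitions UNIV A m)"
    using m by (intro sg_rank_eqI(2)[OF args(1-4)] card_generating_set_ge) simp_all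
qed

text \<open>
  For \<open>m = 1\<close> the ideal consists of the constant maps, which form a right-zero semigroup, so that no
  element can be omitted from a generating set.
\<close>

lemma rank_I_low_1:
  "sg_rank (star a) (I_low a 1) = card (UNIV :: 'x set)"
  "sg_idrank (star a) (I_low a 1) = card (UNIV :: 'x set)"
proof -
  have I: "I_low a 1 = range (\<lambda>x _. x :: 'x)"
  proof (rule set_eqI, rule iffI)
    fix f :: "'x \<Rightarrow> 'x" assume "f \<in> I_low a 1"
    then have "card (range f) = 1" using map_rank_pos[of f] by (simp add: I_low_eq map_rank_def)
    then obtain x where "range f = {x}" by (rule card_1_singletonE)
    then have "f = (\<lambda>_. x)" by (metis ext rangeI singletonD)
    then show "f \<in> range (\<lambda>x _. x :: 'x)" by (rule image_eqI) simp
  next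
    fix f :: "'x \<Rightarrow> 'x" assume "f \<in> range (\<lambda>x _. x :: 'x)"
    then show "f \<in> I_low a 1" using const_in_P by (auto simp: I_low_eq map_rank_def)
  qed
  have cI: "card (I_low a 1) = card (UNIV :: 'x set)"
    unfolding I by (intro card_image injI) (metis)
  have const: "f \<star> g = g" if "g \<in> I_low a 1" for f g :: "'x \<Rightarrow> 'x"
    using that unfolding I by auto
  have gen: "gen (star a) V = V" if "V \<subseteq> I_low a 1" for V
  proof (rule subset_antisym)
    show "gen (star a) V \<subseteq> V"
    proof (rule gen_subset_closed[OF order_refl])
      fix x y assume "x \<in> V" "y \<in> V"
      then show "x \<star> y \<in> V" using const[OF subsetD[OF that]] by (simp only:)
    qed
    show "V \<subseteq> gen (star a) V" by (auto intro: gen.base)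
  qed
  have id: "I_low a 1 \<subseteq> idempotents (star a) (I_low a 1)"
    using const by (auto simp: idempotents_def)
  have low: "card (UNIV :: 'x set) \<le> card V" if "V \<subseteq> I_low a 1" "gen (star a) V = I_low a 1" for V
    using gen[OF that(1)] that(2) cI by simp
  show "sg_rank (star a) (I_low a 1) = card (UNIV :: 'x set)"
    using cI by (intro sg_rank_eqI(1)[OF finite id gen[OF order_refl]] low) simp_all
  show "sg_idrank (star a) (I_low a 1) = card (UNIV :: 'x set)"
    using cI by (intro sg_rank_eqI(2)[OF finite id gen[OF order_refl]] low) simp_all
qed

end

theorem theorem7p4:
  fixes a :: "'x::finite \<Rightarrow> 'x" and n r :: nat
  assumes "card (UNIV :: 'x set) = n"
    and "a \<circ> a = a"
    and "r = map_rank a"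
    and "1 < r" and "r < n"
  shows "{J. is_ideal (star a) (P_reg a) J} = {I_low a m | m. 1 \<le> m \<and> m \<le> r} \<and>
         (\<forall>m. 1 \<le> m \<and> m \<le> r \<longrightarrow> I_low a m = {f \<in> P_reg a. map_rank f \<le> m}) \<and>
         (\<forall>k m. 1 \<le> k \<and> k \<le> m \<and> m \<le> r \<longrightarrow> I_low a k \<subseteq> I_low a m) \<and>
         (\<forall>m. 1 \<le> m \<and> m < r \<longrightarrow>
           I_low a m = gen (star a) (idempotents (star a) (D_cls a m)) \<and>
           sg_rank (star a) (I_low a m) = sg_idrank (star a) (I_low a m) \<and>
           sg_idrank (star a) (I_low a m) = (if m = 1 then n else m ^ (n - r) * Stirling r m))"
proof -
  interpret idempotent_variant a by unfold_locales (rule assms(2))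
  show ?thesis
  proof (intro conjI allI impI)
    show "{J. is_ideal (star a) (P_reg a) J} = {I_low a m | m. 1 \<le> m \<and> m \<le> r}"
    proof (rule set_eqI, unfold mem_Collect_eq, rule iffI)
      fix J assume "is_ideal (star a) (P_reg a) J"
      then show "\<exists>m. J = I_low a m \<and> 1 \<le> m \<and> m \<le> r"
        unfolding assms(3) by (rule ideal_eq_I_low)
    next
      fix J assume "\<exists>m. J = I_low a m \<and> 1 \<le> m \<and> m \<le> r"
      then show "is_ideal (star a) (P_reg a) J" using is_ideal_I_low by blast
    qed
  next
    fix m show "I_low a m = {f \<in> P_reg a. map_rank f \<le> m}" by (rule I_low_eq)
  next
    fix k m assume "1 \<le> k \<and> k \<le> m \<and> m \<le> r"
    then show "I_low a k \<subseteq> I_low a m" by (auto simp: I_low_eq)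
  next
    fix m assume m: "1 \<le> m \<and> m < r"
    then show "I_low a m = gen (star a) (idempotents (star a) (D_cls a m))"
      using assms(3) by (intro I_low_eq_gen) (simp_all add: map_rank_def)
    show "sg_rank (star a) (I_low a m) = sg_idrank (star a) (I_low a m)"
      using rank_I_low[of m] rank_I_low_1 m assms(3) by (cases "m = 1") simp_all
    show "sg_idrank (star a) (I_low a m) = (if m = 1 then n else m ^ (n - r) * Stirling r m)"
      using rank_I_low(2)[of m] rank_I_low_1(2) card_meeting_partitions_A[of m] m assms(1,3)
      by (cases "m = 1") simp_all
  qed
qed

end
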